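(* Let $K$ be a compact connected metric space and let $G$ be an infinite connected, locally finite, regular graph with its path metric. Then $\mathcal{K}(K\times G)$ is plastic, where $K\times G$ carries the supremum metric. In particular, $\mathcal{K}(K\times T_k)$ is plastic for every $k\ge 2$, where $T_k$ is the infinite regular tree of degree $k$.
   Context: Graphs are simple, undirected and unweighted. A connected graph is identified with its vertex set and equipped with the path metric $d(u,v)$ = minimal length of a walk from $u$ to $v$. A graph is locally finite if every vertex has finite degree, and regular if all vertices have the same degree. $T_k$ is the tree (connected acyclic graph) in which every vertex has exactly $k$ neighbours. The supremum metric on a product is the maximum of the two coordinate distances. For a metric space $X$, $\mathcal{K}(X)$ is the set of all nonempty compact subsets of $X$ with the Hausdorff metric. A map $f$ is nonexpansive if $d(f(x),f(y))\le d(x,y)$ for all $x,y$. A metric space is plastic if every bijective nonexpansive self-map is an isometry. *)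

theory Defs
  imports "HOL-Analysis.Analysis" "Graph_Theory.Graph_Theory"
begin

section \<open>Metric spaces\<close>

definition nonexpansive_on :: "'a set \<Rightarrow> ('a \<Rightarrow> 'a \<Rightarrow> real) \<Rightarrow> ('a \<Rightarrow> 'a) \<Rightarrow> bool" where
  "nonexpansive_on M d f \<longleftrightarrow> (\<forall>x\<in>M. \<forall>y\<in>M. d (f x) (f y) \<le> d x y)"

text \<open>An isometry is a distance-preserving bijection; below, bijectivity is already assumed.\<close>

definition plastic :: "'a set \<Rightarrow> ('a \<Rightarrow> 'a \<Rightarrow> real) \<Rightarrow> bool" where
  "plastic M d \<longleftrightarrow>
    (\<forall>f. bij_betw f M M \<and> nonexpansive_on M d f \<longrightarrow> (\<forall>x\<in>M. \<forall>y\<in>M. d (f x) (f y) = d x y))"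

definition sup_dist ::
  "('a \<Rightarrow> 'a \<Rightarrow> real) \<Rightarrow> ('b \<Rightarrow> 'b \<Rightarrow> real) \<Rightarrow> 'a \<times> 'b \<Rightarrow> 'a \<times> 'b \<Rightarrow> real" where
  "sup_dist d1 d2 = (\<lambda>(x, y) (x', y'). max (d1 x x') (d2 y y'))"

definition nonempty_compacts :: "'a set \<Rightarrow> ('a \<Rightarrow> 'a \<Rightarrow> real) \<Rightarrow> 'a set set" where
  "nonempty_compacts M d = {A. compactin (Metric_space.mtopology M d) A \<and> A \<noteq> {}}"

text \<open>The suprema and infima are real-valued, hence meaningful only for nonempty bounded sets,
  in particular for the members of \<^const>\<open>nonempty_compacts\<close>.\<close>

definition hausdorff_dist :: "('a \<Rightarrow> 'a \<Rightarrow> real) \<Rightarrow> 'a set \<Rightarrow> 'a set \<Rightarrow> real" where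
  "hausdorff_dist d A B =
    max (SUP a\<in>A. INF b\<in>B. d a b) (SUP b\<in>B. INF a\<in>A. d a b)"

section \<open>Graphs\<close>

text \<open>A simple undirected graph is a loop-free symmetric digraph without parallel arcs, on a
  possibly infinite vertex set: an edge \<open>{u, v}\<close> is the pair of arcs \<open>(u, v)\<close>, \<open>(v, u)\<close>.
  (\<^locale>\<open>pair_graph\<close> would in addition require finiteness.) The degree of a vertex
  is therefore its \<^const>\<open>out_degree\<close>, and connectedness is \<^const>\<open>Digraph_Component.connected\<close>,
  which also requires a vertex.\<close>

abbreviation simple_graph :: "'a pair_pre_digraph \<Rightarrow> bool" where
  "simple_graph \<equiv> pair_bidirected_digraph"

definition path_dist :: "'a pair_pre_digraph \<Rightarrow> 'a \<Rightarrow> 'a \<Rightarrow> real" where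
  "path_dist G u v = real (LEAST n. \<exists>p. pre_digraph.awalk (with_proj G) u p v \<and> length p = n)"

definition locally_finite :: "'a pair_pre_digraph \<Rightarrow> bool" where
  "locally_finite G \<longleftrightarrow> (\<forall>v\<in>pverts G. finite (out_arcs (with_proj G) v))"

definition regular :: "'a pair_pre_digraph \<Rightarrow> bool" where
  "regular G \<longleftrightarrow> (\<exists>k. \<forall>v\<in>pverts G. out_degree (with_proj G) v = k)"

text \<open>Since an edge traversed back and forth is a \<^const>\<open>pre_digraph.cycle\<close> of length 2, the
  library predicates \<^const>\<open>forest\<close> and \<^const>\<open>tree\<close> reject every symmetric digraph with an
  edge. Cycles of an undirected simple graph are those of length at least 3.\<close>

definition undirected_tree :: "'a pair_pre_digraph \<Rightarrow> bool" where
  "undirected_tree G \<longleftrightarrow> simple_graph G \<and> Digraph_Component.connected (with_proj G) \<and>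
    \<not> (\<exists>p. pre_digraph.cycle (with_proj G) p \<and> 3 \<le> length p)"

text \<open>Says that \<open>T\<close> is (a copy of) the tree \<open>T\<^sub>k\<close>.\<close>

definition is_regular_tree :: "nat \<Rightarrow> 'a pair_pre_digraph \<Rightarrow> bool" where
  "is_regular_tree k T \<longleftrightarrow> undirected_tree T \<and> locally_finite T \<and>
    (\<forall>v\<in>pverts T. out_degree (with_proj T) v = k)"

section \<open>The distances are metrics\<close>

lemma Metric_space_sup_dist:
  assumes "Metric_space M1 d1" "Metric_space M2 d2"
  shows "Metric_space (M1 \<times> M2) (sup_dist d1 d2)"
proof -
  interpret M1: Metric_space M1 d1 by fact
  interpret M2: Metric_space M2 d2 by fact
  show ?thesis
  proof
    fix p q show "0 \<le> sup_dist d1 d2 p q" "sup_dist d1 d2 p q = sup_dist d1 d2 q p"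
      by (auto simp: sup_dist_def max_def M1.commute M2.commute split: prod.splits)
  next
    fix p q assume "p \<in> M1 \<times> M2" "q \<in> M1 \<times> M2"
    then show "sup_dist d1 d2 p q = 0 \<longleftrightarrow> p = q"
      by (auto simp: sup_dist_def max_def split: prod.splits)
         (metis M1.nonneg M1.zero M2.nonneg M2.zero order_antisym)+
  next
    fix p q r assume "p \<in> M1 \<times> M2" "q \<in> M1 \<times> M2" "r \<in> M1 \<times> M2"
    then obtain a b a' b' a'' b'' where
      e: "p = (a, b)" "q = (a', b')" "r = (a'', b'')"
         "a \<in> M1" "a' \<in> M1" "a'' \<in> M1" "b \<in> M2" "b' \<in> M2" "b'' \<in> M2" by auto
    have "d1 a a'' \<le> d1 a a' + d1 a' a''" "d2 b b'' \<le> d2 b b' + d2 b' b''"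
      using e M1.triangle M2.triangle by auto
    then show "sup_dist d1 d2 p r \<le> sup_dist d1 d2 p q + sup_dist d1 d2 q r"
      using e by (auto simp: sup_dist_def)
  qed
qed

lemma Metric_space_path_dist:
  assumes "simple_graph G" "Digraph_Component.connected (with_proj G)"
  shows "Metric_space (pverts G) (path_dist G)"
proof -
  interpret pair_bidirected_digraph G by fact
  define P where "P u v n \<longleftrightarrow> (\<exists>p. awalk u p v \<and> length p = n)" for u v n
  have pd: "path_dist G u v = real (LEAST n. P u v n)" for u v
    by (simp add: path_dist_def P_def)
  have sym: "P v u n" if "P u v n" for u v n
  proof -
    have "length (rev_path p) = length p" for p :: "('a \<times> 'a) list" by (induct p) auto
    then show ?thesis using that awalk_rev_path unfolding P_def by metis
  qed
  have ex: "\<exists>n. P u v n" if "u \<in> pverts G" "v \<in> pverts G" for u v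
  proof -
    have "u \<rightarrow>\<^sup>*\<^bsub>with_proj G\<^esub> v"
      using that assms(2) unfolding Digraph_Component.connected_def strongly_connected_def
      by (simp add: reachable_mk_symmetric_eq[OF pair_sym_arcs])
    then show ?thesis unfolding P_def reachable_awalk by blast
  qed
  show ?thesis
  proof
    fix u v show "0 \<le> path_dist G u v" by (simp add: pd)
    have "P u v = P v u" using sym by (intro ext) blast
    then show "path_dist G u v = path_dist G v u" by (simp add: pd)
  next
    fix u v assume uv: "u \<in> pverts G" "v \<in> pverts G"
    show "path_dist G u v = 0 \<longleftrightarrow> u = v"
    proof
      assume "path_dist G u v = 0"
      then have "P u v 0" using LeastI_ex[OF ex[OF uv]] by (simp add: pd)
      then show "u = v" unfolding P_def by (auto simp: awalk_def)
    next
      assume "u = v"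
      then have "P u v 0" using uv unfolding P_def by (auto simp: awalk_def)
      then show "path_dist G u v = 0" by (simp add: pd Least_eq_0)
    qed
  next
    fix u v w assume V: "u \<in> pverts G" "v \<in> pverts G" "w \<in> pverts G"
    have "P u v (LEAST n. P u v n)" "P v w (LEAST n. P v w n)"
      using LeastI_ex[OF ex] V by blast+
    then have "P u w ((LEAST n. P u v n) + (LEAST n. P v w n))"
      unfolding P_def by (metis awalk_appendI length_append)
    then have "(LEAST n. P u w n) \<le> (LEAST n. P u v n) + (LEAST n. P v w n)"
      by (rule Least_le)
    then show "path_dist G u w \<le> path_dist G u v + path_dist G v w"
      by (simp add: pd)
  qed
qed


section \<open>Regular trees exist\<close>

text \<open>The Cayley graph of the free product of \<open>k\<close> copies of the group of order 2: words over
  \<open>k\<close> letters without equal adjacent letters, joined when one prepends a letter to the other.\<close>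

definition word_tree :: "nat \<Rightarrow> nat list pair_pre_digraph" where
  "word_tree k = (let W = {w. set w \<subseteq> {..<k} \<and> successively (\<noteq>) w} in
    \<lparr> pverts = W, parcs = {(u, v). u \<in> W \<and> v \<in> W \<and> (\<exists>a. u = a # v \<or> v = a # u)} \<rparr>)"

lemma is_regular_tree_word_tree: "is_regular_tree k (word_tree k)"
proof -
  let ?T = "word_tree k"
  define W where "W = {w. set w \<subseteq> {..<k} \<and> successively (\<noteq>) w}"
  have V: "pverts ?T = W"
    and A: "parcs ?T = {(u, v). u \<in> W \<and> v \<in> W \<and> (\<exists>a. u = a # v \<or> v = a # u)}"
    by (simp_all add: word_tree_def W_def Let_def)
  interpret pair_bidirected_digraph ?T
  proof
    show "symmetric (with_proj ?T)" unfolding symmetric_def by (auto simp: A intro!: symI)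
  qed (auto simp: A V)
  have W_Cons: "a # w \<in> W \<longleftrightarrow> a < k \<and> w \<in> W \<and> (w = [] \<or> a \<noteq> hd w)" for a w
    by (cases w) (auto simp: W_def)
  have "[] \<in> W" by (simp add: W_def)

  have deg: "finite (out_arcs (with_proj ?T) w)" "out_degree (with_proj ?T) w = k"
    if w: "w \<in> W" for w
  proof -
    define h where "h a = (w, if w \<noteq> [] \<and> a = hd w then tl w else a # w)" for a
    have inj: "inj_on h {..<k}"
    proof (rule inj_onI)
      fix a b assume "h a = h b"
      moreover have "tl w \<noteq> c # w" for c
        by (metis length_Cons length_tl diff_le_self Suc_n_not_le_n)
      moreover have "c # w \<noteq> tl w" for c
        by (metis length_Cons length_tl diff_le_self Suc_n_not_le_n)
      ultimately show "a = b" by (auto simp: h_def split: if_splits)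
    qed
    have "out_arcs (with_proj ?T) w = h ` {..<k}"
    proof (intro equalityI subsetI)
      fix e assume "e \<in> out_arcs (with_proj ?T) w"
      then obtain v a where e: "e = (w, v)" "v \<in> W" "w = a # v \<or> v = a # w"
        by (auto simp: A)
      then have "e = h a" "a < k" using w by (auto simp: h_def W_Cons)
      then show "e \<in> h ` {..<k}" by simp
    next
      fix e assume "e \<in> h ` {..<k}"
      then show "e \<in> out_arcs (with_proj ?T) w"
        using w by (cases w) (auto simp: A h_def W_Cons)
    qed
    then show "finite (out_arcs (with_proj ?T) w)" "out_degree (with_proj ?T) w = k"
      using inj by (simp_all add: out_degree_def card_image)
  qed

  have root: "w \<rightarrow>\<^sup>*\<^bsub>with_proj ?T\<^esub> []" if "w \<in> W" for w
    using that
  proof (induct w)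
    case Nil
    then show ?case by (simp add: V)
  next
    case (Cons a w)
    then have "(a # w, w) \<in> parcs ?T" "w \<in> W" by (auto simp: A W_Cons)
    then show ?case using Cons.hyps adj_reachable_trans by simp
  qed
  have "u \<rightarrow>\<^sup>*\<^bsub>with_proj ?T\<^esub> v" if "u \<in> W" "v \<in> W" for u v
    using that root symmetric_reachable' reachable_trans by blast
  then have conn: "Digraph_Component.connected (with_proj ?T)"
    unfolding Digraph_Component.connected_def strongly_connected_def
    using \<open>[] \<in> W\<close> V pair_sym_arcs by (auto simp: reachable_mk_symmetric_eq)

  have step: "(pawalk_verts u p ! i, pawalk_verts u p ! Suc i) \<in> parcs ?T"
    if "awalk u p v" "i < length p" for u p v i
    using that
  proof (induct p arbitrary: u i)
    case Nil
    then show ?case by simp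
  next
    case (Cons e p)
    then have "e \<in> parcs ?T" "fst e = u" "awalk (snd e) p v" by (auto simp: awalk_Cons_iff)
    then show ?case using Cons by (cases i; cases p) (auto simp: awalk_Cons_iff)
  qed
  have acyclic: "False" if p: "cycle p" "3 \<le> length p" for p
  proof -
    obtain u where u: "awalk u p u" "distinct (tl (pawalk_verts u p))"
      using p(1) unfolding cycle_def by blast
    define n where "n = length p"
    define x where "x i = pawalk_verts u p ! i" for i
    have len: "length (pawalk_verts u p) = Suc n" unfolding n_def by (induct p arbitrary: u) auto
    have arc: "(x i, x (Suc i)) \<in> parcs ?T" if "i < n" for i
      using step[OF u(1)] that by (simp add: x_def n_def)
    have closed: "x 0 = x n"
    proof -
      have "x 0 = u" unfolding x_def using u(1) by (cases p) (auto simp: awalk_Cons_iff)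
      moreover have "last (pawalk_verts u p) = u" using u(1) awlast_if_cas
        by (simp add: awalk_def)
      then have "x n = u" unfolding x_def using len
        by (metis diff_Suc_1 last_conv_nth length_0_conv nat.distinct(1))
      ultimately show ?thesis by simp
    qed
    have dist: "i = j" if "x i = x j" "1 \<le> i" "i \<le> n" "1 \<le> j" "j \<le> n" for i j
    proof -
      have "tl (pawalk_verts u p) ! (i - 1) = tl (pawalk_verts u p) ! (j - 1)"
        using that len by (simp add: x_def nth_tl)
      then have "i - 1 = j - 1" using u(2) that len by (subst (asm) nth_eq_iff_index_eq) auto
      then show ?thesis using that by simp
    qed
    have n: "3 \<le> n" using p by (simp add: n_def)
    have "\<exists>m\<in>{1..n}. \<forall>i\<in>{1..n}. length (x i) \<le> length (x m)"
    proof -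
      have "Max ((\<lambda>i. length (x i)) ` {1..n}) \<in> (\<lambda>i. length (x i)) ` {1..n}"
        using n by (intro Max_in) auto
      then obtain m where "m \<in> {1..n}" "Max ((\<lambda>i. length (x i)) ` {1..n}) = length (x m)"
        by auto
      then show ?thesis by (metis Max_ge finite_atLeastAtMost finite_imageI imageI)
    qed
    then obtain m where m: "1 \<le> m" "m \<le> n"
      and le: "\<And>i. 1 \<le> i \<Longrightarrow> i \<le> n \<Longrightarrow> length (x i) \<le> length (x m)" by auto
    have parent: "x i = tl (x m)"
      if "1 \<le> i" "i \<le> n" "(x i, x m) \<in> parcs ?T \<or> (x m, x i) \<in> parcs ?T" for i
      using that(3) le[OF that(1,2)] by (auto simp: A)
    define a where "a = (if m = 1 then n else m - 1)"
    define b where "b = (if m = n then 1 else Suc m)"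
    have "(x a, x m) \<in> parcs ?T"
      using arc[of "m - 1"] m closed by (auto simp: a_def)
    moreover have "(x m, x b) \<in> parcs ?T"
      using arc[of m] arc[of 0] m n closed by (auto simp: b_def)
    moreover have ab: "1 \<le> a" "a \<le> n" "1 \<le> b" "b \<le> n" "a \<noteq> b"
      using m n by (auto simp: a_def b_def)
    ultimately show False using parent dist by metis
  qed
  have "undirected_tree ?T"
    unfolding undirected_tree_def using conn acyclic pair_bidirected_digraph_axioms by blast
  then show ?thesis
    using deg unfolding is_regular_tree_def locally_finite_def V by blast
qed

end

theory Submission
  imports Defs
begin

text \<open>Let \<open>V\<close> be the vertex set. The projection \<open>F\<close> of a compact set \<open>A \<subseteq> K \<times> V\<close> to \<open>V\<close> is
  finite, and compact sets with different projections have Hausdorff distance at least 1. The sets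
  with a fixed projection \<open>F\<close> form a layer, which is compact (lemma \<open>compactin_layer\<close>) and
  connected (lemma \<open>connectedin_layer\<close>): fattening a set in small steps leads to \<open>K \<times> F\<close>,
  because \<open>K\<close> is a continuum. So a nonexpansive bijection \<open>f\<close> of the hyperspace induces a nonexpansive surjection \<open>\<phi>\<close> of the finite nonempty vertex sets.
  It is injective: a layer is a continuum, and by Sierpinski's theorem a continuum is not the
  union of several, at most countably many, disjoint nonempty closed sets, here the \<open>f\<close>-images of
  the layers that \<open>f\<close> maps into it.

  The heart of the proof is to recover from \<open>\<phi>\<close> an automorphism of the graph (theorem
  \<open>vertex_automorphism\<close>). If the degree is \<open>k\<close>, exactly \<open>2 ^ (k + 1) - 1\<close> sets lie within
  distance 1 of a singleton, and every finite set has at least as many sets within distance 1, with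
  equality only if its vertices are twins, that is, have the same closed neighbourhood. Since
  \<open>\<phi>\<close> maps 1-balls injectively into 1-balls, preimages of sets of twins are sets of twins.
  Singletons need not be preserved: if \<open>u\<close> and \<open>v\<close> are twins, exchanging \<open>{u}\<close> with \<open>{u, v}\<close> is
  an isometry of the finite vertex sets. But \<open>\<phi>\<close> does determine a map of twin classes, and this
  lifts to an automorphism \<open>\<gamma>\<close> of the graph such that \<open>F \<mapsto> \<phi> (\<gamma> ` F)\<close> permutes the nonempty subsets
  of every ball of integer radius at least 1.

  Consequently \<open>f\<close> composed with the isometry that \<open>\<gamma>\<close> induces on the hyperspace permutes, for
  every such ball \<open>B\<close>, the compact subsets of \<open>K \<times> B\<close>. These form a totally bounded space,
  and a nonexpansive bijection of a totally bounded space is an isometry (theorem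
  \<open>nonexpansive_bij_isometry\<close>). Any two compact sets lie over a common ball, so the composition,
  and with it \<open>f\<close>, is an isometry.\<close>

section \<open>Continua are not countable disjoint unions of closed sets\<close>

text \<open>The inductive step of Sierpinski's theorem. Separate \<open>A n\<close> from another nonempty piece
  \<open>A m\<close> by open sets \<open>U\<close> and \<open>V\<close>, and take the component \<open>C\<close> of a point of \<open>A m\<close> in the complement
  of \<open>U\<close>. By boundary bumping \<open>C\<close> reaches the frontier of \<open>U\<close>, so it leaves \<open>V\<close> and is not
  contained in \<open>A m\<close>.\<close>

lemma continuum_avoiding_closed_piece:
  assumes X: "connected_space X" "compact_space X" "Hausdorff_space X"
    and clo: "\<And>n::nat. closedin X (A n)" and dis: "disjoint_family A"
    and cover: "(\<Union>n. A n) = topspace X"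
    and many: "topspace X \<noteq> {}" "\<And>i. \<not> topspace X \<subseteq> A i"
  obtains C where "closedin X C" "connectedin X C" "C \<noteq> {}" "C \<inter> A n = {}" "\<And>i. \<not> C \<subseteq> A i"
proof -
  obtain b where b: "b \<in> topspace X" "b \<notin> A n"
    using many(2)[of n] by blast
  then obtain m where m: "m \<noteq> n" "b \<in> A m"
    using cover by (metis UN_E)
  have "disjnt (A n) (A m)"
    using dis m(1) by (auto simp: disjoint_family_on_def disjnt_def)
  then obtain U V where UV: "openin X U" "openin X V" "A n \<subseteq> U" "A m \<subseteq> V" "disjnt U V"
    using compact_Hausdorff_or_regular_imp_normal_space X clo unfolding normal_space_def by metis
  define S where "S = topspace X - U"
  have S: "closedin X S" unfolding S_def using UV(1) by (intro closedin_diff closedin_topspace)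
  have VS: "V \<subseteq> S" using UV(2,5) openin_subset by (fastforce simp: S_def disjnt_iff)
  show thesis
  proof (cases "A n = {}")
    case True
    then show thesis
      using that[of "topspace X"] X(1) many by (simp add: connectedin_topspace)
  next
    case False
    then have proper: "S \<noteq> topspace X"
      using UV(3) cover by (auto simp: S_def)
    define C where "C = connected_component_of_set (subtopology X S) b"
    have bS: "b \<in> topspace (subtopology X S)"
      using m(2) UV(4) VS S closedin_subset by fastforce
    have CS: "C \<in> connected_components_of (subtopology X S)"
      unfolding C_def using bS by (rule connected_component_in_connected_components_of[THEN iffD2])
    have bC: "b \<in> C" unfolding C_def using bS by (simp add: connected_component_of_refl)
    have "C \<inter> X frontier_of S \<noteq> {}"
      by (rule boundary_bumping_theorem_closed[OF X S proper CS])
    moreover have "A m \<inter> X frontier_of S = {}"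
      using UV(2,4) VS interior_of_maximal[of V S X] by (auto simp: frontier_of_def)
    ultimately obtain c where c: "c \<in> C" "c \<notin> A m" by blast
    show thesis
    proof (rule that[of C])
      show "closedin X C"
        using closedin_connected_components_of[OF CS] S closedin_trans_full by blast
      show "connectedin X C"
        using connectedin_connected_components_of[OF CS] connectedin_subtopology by blast
      show "C \<inter> A n = {}"
        using connected_components_of_subset[OF CS] UV(3) by (auto simp: S_def)
      show "\<not> C \<subseteq> A i" for i
        using c bC m(2) dis by (cases "i = m") (auto simp: disjoint_family_on_def)
    qed (use bC in auto)
  qed
qed

text \<open>Otherwise, repeatedly passing to subcontinua that avoid \<open>A 0\<close>, \<open>A 1\<close>, \<dots> gives a
  decreasing sequence of nonempty closed sets whose intersection misses every piece.\<close>

theorem Sierpinski_continuum: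
  assumes X: "connected_space X" "compact_space X" "Hausdorff_space X" "topspace X \<noteq> {}"
    and clo: "\<And>n::nat. closedin X (A n)" and dis: "disjoint_family A"
    and cover: "(\<Union>n. A n) = topspace X"
  shows "\<exists>i. A i = topspace X"
proof (rule ccontr)
  assume "\<nexists>i. A i = topspace X"
  then have many: "\<not> topspace X \<subseteq> A i" for i
    using clo closedin_subset by blast
  define P where
    "P C \<longleftrightarrow> closedin X C \<and> connectedin X C \<and> C \<noteq> {} \<and> (\<forall>i. \<not> C \<subseteq> A i)" for C
  have step: "\<exists>C'. P C' \<and> C' \<subseteq> C \<and> C' \<inter> A n = {}" if C: "P C" for C n
  proof -
    let ?Y = "subtopology X C"
    have CX: "C \<subseteq> topspace X" "topspace ?Y = C"
      using C closedin_subset by (auto simp: P_def)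
    have Y: "connected_space ?Y" "compact_space ?Y" "Hausdorff_space ?Y"
      using C X by (auto simp: P_def connectedin_def compact_space_subtopology closedin_compact_space
          Hausdorff_space_subtopology)
    obtain D where "closedin ?Y D" "connectedin ?Y D" "D \<noteq> {}" "D \<inter> (C \<inter> A n) = {}"
      "\<And>i. \<not> D \<subseteq> C \<inter> A i"
    proof (rule continuum_avoiding_closed_piece[OF Y, of "\<lambda>n. C \<inter> A n" n])
      show "closedin ?Y (C \<inter> A n)" for n
        using clo by (auto simp: closedin_subtopology)
      show "disjoint_family (\<lambda>n. C \<inter> A n)"
        using dis by (auto simp: disjoint_family_on_def)
    qed (use C CX cover in \<open>auto simp: P_def\<close>)
    then have "D \<subseteq> C" "P D"
      using C closedin_trans_full[of X C D] connectedin_subtopology[of X C D] unfolding P_def by blast+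
    with \<open>D \<inter> (C \<inter> A n) = {}\<close> show ?thesis by blast
  qed
  have "P (topspace X)"
    using X many by (simp add: P_def connectedin_topspace)
  then obtain C where C: "\<And>n. P (C n)" "\<And>n. C (Suc n) \<subseteq> C n \<and> C (Suc n) \<inter> A n = {}"
    using dependent_nat_choice[of "\<lambda>_. P" "\<lambda>n C C'. C' \<subseteq> C \<and> C' \<inter> A n = {}"] step by metis
  have "(\<Inter>n. C n) \<noteq> {}"
  proof (rule compact_space_imp_nest)
    show "decseq C" using C(2) by (simp add: decseq_Suc_iff)
  qed (use C(1) X in \<open>auto simp: P_def\<close>)
  then obtain x where x: "\<And>n. x \<in> C n" by blast
  then have "x \<in> topspace X" using C(1) closedin_subset unfolding P_def by blast
  then obtain n where "x \<in> A n" using cover by auto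
  with x C(2) show False by blast
qed

text \<open>The form for families of nonempty sets; indices outside the range of the enumeration get
  the empty set, which the sequence form admits.\<close>

theorem Sierpinski_countable_family:
  assumes X: "connected_space X" "compact_space X" "Hausdorff_space X" "topspace X \<noteq> {}"
    and \<U>: "countable \<U>" "pairwise disjnt \<U>" "\<And>C. C \<in> \<U> \<Longrightarrow> closedin X C \<and> C \<noteq> {}"
    and cover: "\<Union>\<U> = topspace X"
  shows "\<U> = {topspace X}"
proof -
  define A where "A n = \<Union>{C \<in> \<U>. to_nat_on \<U> C = n}" for n
  have inj: "C = C'" if "C \<in> \<U>" "C' \<in> \<U>" "to_nat_on \<U> C = to_nat_on \<U> C'" for C C'
    using inj_on_to_nat_on[OF \<U>(1)] that by (auto dest: inj_onD)
  have A: "A (to_nat_on \<U> C) = C" if "C \<in> \<U>" for C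
    using inj that unfolding A_def by blast
  have A': "A n = {}" if "n \<notin> to_nat_on \<U> ` \<U>" for n
    using that by (auto simp: A_def)
  have disj: "disjoint_family A"
    unfolding disjoint_family_on_def
  proof (intro ballI impI)
    fix m n :: nat assume mn: "m \<noteq> n"
    have "disjnt C C'" if "C \<in> \<U>" "to_nat_on \<U> C = m" "C' \<in> \<U>" "to_nat_on \<U> C' = n" for C C'
      using that mn \<U>(2) by (auto simp: pairwise_def)
    then show "A m \<inter> A n = {}" unfolding A_def disjnt_iff by blast
  qed
  obtain i where i: "A i = topspace X"
  proof -
    have "closedin X (A n)" for n
      using A A' \<U>(3) closedin_empty by (metis imageE)
    moreover have "(\<Union>n. A n) = topspace X" using cover unfolding A_def by blast
    ultimately show thesis using Sierpinski_continuum[OF X _ disj] that by blast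
  qed
  then obtain C where C: "C \<in> \<U>" "topspace X = C" using A A' X(4) by (metis imageE)
  have "C' = C" if C': "C' \<in> \<U>" for C'
  proof (rule ccontr)
    assume "C' \<noteq> C"
    then have "disjnt C' C" using \<U>(2) C' C(1) by (auto simp: pairwise_def)
    moreover have "C' \<subseteq> C" using cover C' C(2) by blast
    ultimately show False using \<U>(3)[OF C'] by (auto simp: disjnt_def)
  qed
  then show ?thesis using C by blast
qed

section \<open>Nonexpansive bijections of totally bounded spaces\<close>

lemma nonexpansive_imp_continuous_map:
  assumes "Metric_space M d" "Metric_space M' d'" and f: "f \<in> M \<rightarrow> M'"
    and ne: "\<And>x y. x \<in> M \<Longrightarrow> y \<in> M \<Longrightarrow> d' (f x) (f y) \<le> d x y"
  shows "continuous_map (Metric_space.mtopology M d) (Metric_space.mtopology M' d') f"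
proof -
  interpret M: Metric_space M d by fact
  interpret M': Metric_space M' d' by fact
  show ?thesis
    unfolding M'.continuous_map_to_metric
  proof (intro ballI allI impI)
    fix x and \<epsilon> :: real assume "x \<in> topspace M.mtopology" "0 < \<epsilon>"
    moreover have "f y \<in> M'.mball (f x) \<epsilon>" if "y \<in> M.mball x \<epsilon>" for y
      using that f ne[of x y] by auto
    ultimately show "\<exists>U. openin M.mtopology U \<and> x \<in> U \<and> (\<forall>y\<in>U. f y \<in> M'.mball (f x) \<epsilon>)"
      by (intro exI[of _ "M.mball x \<epsilon>"]) auto
  qed
qed

context Metric_space
begin

text \<open>The inverse \<open>g\<close> is expanding. By total boundedness the \<open>g\<close>-orbits of two points \<open>u\<close>, \<open>v\<close> come
  simultaneously back close to themselves, say at times \<open>m\<close> and \<open>m + Suc p\<close>. As \<open>g ^^ m\<close> expands,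
  already \<open>(g ^^ Suc p) u\<close> and \<open>(g ^^ Suc p) v\<close> are close to \<open>u\<close> and \<open>v\<close>, and the distance of
  \<open>g u\<close> and \<open>g v\<close>, which lies between those of the pairs at times 0 and \<open>Suc p\<close>, is at most that
  of \<open>u\<close> and \<open>v\<close> up to an arbitrarily small error.\<close>

theorem nonexpansive_bij_isometry:
  assumes tb: "mtotally_bounded S" and f: "bij_betw f S S"
    and ne: "\<And>x y. x \<in> S \<Longrightarrow> y \<in> S \<Longrightarrow> d (f x) (f y) \<le> d x y"
    and xy: "x \<in> S" "y \<in> S"
  shows "d (f x) (f y) = d x y"
proof -
  have SM: "S \<subseteq> M" using tb mtotally_bounded_imp_subset by blast
  define g where "g = inv_into S f"
  have g: "g z \<in> S" "f (g z) = z" if "z \<in> S" for z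
    using that f by (auto simp: g_def bij_betw_def inv_into_into f_inv_into_f)
  have gn: "(g ^^ n) z \<in> S" if "z \<in> S" for n z
    using that by (induct n) (auto simp: g)
  have expand: "d z w \<le> d ((g ^^ n) z) ((g ^^ n) w)" if "z \<in> S" "w \<in> S" for n z w
  proof (induct n)
    case (Suc n)
    have "d ((g ^^ n) z) ((g ^^ n) w) \<le> d ((g ^^ Suc n) z) ((g ^^ Suc n) w)"
      using ne[of "(g ^^ Suc n) z" "(g ^^ Suc n) w"] gn[OF that(1)] gn[OF that(2)] g by simp
    with Suc show ?case by linarith
  qed simp
  have returns: "d (g u) (g v) \<le> d u v + 2 * \<epsilon>" if \<epsilon>: "\<epsilon> > 0" and uv: "u \<in> S" "v \<in> S" for \<epsilon> u v
  proof -
    obtain r where r: "strict_mono r" "MCauchy ((\<lambda>n. (g ^^ n) u) \<circ> r)"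
      using tb gn uv unfolding mtotally_bounded_sequentially by (metis (no_types, lifting) image_subsetI)
    \<comment> \<open>refine the subsequence for \<open>u\<close>, so that both orbits are Cauchy along the same times\<close>
    obtain q where q: "strict_mono q" "MCauchy ((\<lambda>n. (g ^^ (r n)) v) \<circ> q)"
      using tb gn uv unfolding mtotally_bounded_sequentially by (metis (no_types, lifting) image_subsetI)
    obtain N1 where N1: "\<And>m n. m \<ge> N1 \<Longrightarrow> n \<ge> N1 \<Longrightarrow> d ((g ^^ r m) u) ((g ^^ r n) u) < \<epsilon>"
      using r(2) \<epsilon> unfolding MCauchy_def o_def by meson
    obtain N2 where N2: "\<And>m n. m \<ge> N2 \<Longrightarrow> n \<ge> N2 \<Longrightarrow> d ((g ^^ r (q m)) v) ((g ^^ r (q n)) v) < \<epsilon>"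
      using q(2) \<epsilon> unfolding MCauchy_def o_def by meson
    define m where "m = r (q (max N1 N2))"
    define n where "n = r (q (Suc (max N1 N2)))"
    have qi: "i \<le> q i" for i using strict_mono_imp_increasing[OF q(1)] .
    have mn: "m < n" using r(1) q(1) by (auto simp: m_def n_def strict_mono_def)
    have du: "d ((g ^^ m) u) ((g ^^ n) u) < \<epsilon>"
      unfolding m_def n_def using qi[of "max N1 N2"] qi[of "Suc (max N1 N2)"] by (intro N1) linarith+
    have dv: "d ((g ^^ m) v) ((g ^^ n) v) < \<epsilon>"
      unfolding m_def n_def by (intro N2) linarith+
    obtain p where p: "n = m + Suc p" using mn less_iff_Suc_add by auto
    let ?u = "(g ^^ Suc p) u" and ?v = "(g ^^ Suc p) v"
    have "d u ?u < \<epsilon>" "d v ?v < \<epsilon>"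
      using du dv expand[of u ?u m] expand[of v ?v m] uv gn[of _ "Suc p"] unfolding p funpow_add
      by (simp_all del: funpow.simps)
    moreover have "d ?u ?v \<le> d ?u u + d u v + d v ?v"
      using triangle[of ?u u ?v] triangle[of u v ?v] gn[OF uv(1), of "Suc p"] gn[OF uv(2), of "Suc p"] uv SM
      by (smt (verit) subsetD)
    moreover have "d (g u) (g v) \<le> d ?u ?v"
      using expand[of "g u" "g v" p] g uv by (simp add: funpow_swap1)
    ultimately show ?thesis using commute[of ?u u] by linarith
  qed
  have "d (g (f x)) (g (f y)) \<le> d (f x) (f y) + \<epsilon>" if "\<epsilon> > 0" for \<epsilon>
    using returns[of "\<epsilon>/2" "f x" "f y"] that xy f by (auto simp: bij_betw_def)
  then have "d (g (f x)) (g (f y)) \<le> d (f x) (f y)"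
    by (rule field_le_epsilon)
  moreover have "g (f z) = z" if "z \<in> S" for z
    using that f by (auto simp: g_def bij_betw_def inv_into_f_f)
  ultimately show ?thesis using ne xy by (metis order_antisym)
qed

end

section \<open>The hyperspace of nonempty compact sets\<close>

text \<open>Hausdorff distance at most \<open>r\<close>, without suprema. It also serves for vertex sets, where only
  natural radii occur.\<close>

definition hausdorff_within :: "('a \<Rightarrow> 'a \<Rightarrow> real) \<Rightarrow> real \<Rightarrow> 'a set \<Rightarrow> 'a set \<Rightarrow> bool" where
  "hausdorff_within d r A B \<longleftrightarrow> (\<forall>a\<in>A. \<exists>b\<in>B. d a b \<le> r) \<and> (\<forall>b\<in>B. \<exists>a\<in>A. d a b \<le> r)"

context Metric_space
begin

lemma nonempty_compactsD:
  assumes "A \<in> nonempty_compacts M d"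
  shows "compactin mtopology A" "A \<noteq> {}" "A \<subseteq> M"
  using assms compactin_subset_topspace by (fastforce simp: nonempty_compacts_def)+

lemma compactin_attains_mdist:
  assumes x: "x \<in> M" and B: "compactin mtopology B" "B \<noteq> {}"
  obtains b where "b \<in> B" "\<And>b'. b' \<in> B \<Longrightarrow> d x b \<le> d x b'"
proof -
  have "continuous_map mtopology euclidean (d x)"
    using x continuous_map_mdist[of mtopology Self "\<lambda>_. x" "\<lambda>y. y"] by (simp add: Self_def)
  then have "compact (d x ` B)"
    using image_compactin[OF B(1)] by (metis compactin_euclidean_iff)
  then show thesis
    using compact_attains_inf[of "d x ` B"] B(2) that by auto
qed

lemma closedin_thickening:
  assumes A: "compactin mtopology A"
  shows "closedin mtopology {p \<in> M. \<exists>a\<in>A. d p a \<le> \<delta>}"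
  unfolding closedin_metric
proof (intro conjI allI impI)
  fix x assume x: "x \<in> M - {p \<in> M. \<exists>a\<in>A. d p a \<le> \<delta>}"
  have AM: "A \<subseteq> M" using A compactin_subset_topspace by fastforce
  show "\<exists>r>0. disjnt {p \<in> M. \<exists>a\<in>A. d p a \<le> \<delta>} (mball x r)"
  proof (cases "A = {}")
    case False
    then obtain b where b: "b \<in> A" "\<And>a. a \<in> A \<Longrightarrow> d x b \<le> d x a"
      using compactin_attains_mdist[of x A] x A by blast
    have "False" if "p \<in> M" "a \<in> A" "d p a \<le> \<delta>" "d x p < d x b - \<delta>" for p a
      using triangle[of x p a] b(2)[of a] that x AM by fastforce
    then have "disjnt {p \<in> M. \<exists>a\<in>A. d p a \<le> \<delta>} (mball x (d x b - \<delta>))"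
      by (auto simp: disjnt_iff)
    moreover have "d x b - \<delta> > 0" using x b(1) by force
    ultimately show ?thesis by blast
  qed (auto simp: disjnt_iff intro: exI[of _ 1])
qed auto

text \<open>Compactness is needed twice: it makes the infima attained, and the suprema bounded.\<close>

lemma hausdorff_dist_le_iff:
  assumes A: "A \<in> nonempty_compacts M d" and B: "B \<in> nonempty_compacts M d"
  shows "hausdorff_dist d A B \<le> r \<longleftrightarrow> hausdorff_within d r A B"
proof -
  have *: "(SUP a\<in>A. INF b\<in>B. e a b) \<le> r \<longleftrightarrow> (\<forall>a\<in>A. \<exists>b\<in>B. e a b \<le> r)"
    if AB: "A \<in> nonempty_compacts M d" "B \<in> nonempty_compacts M d"
      and e: "\<And>a b. a \<in> A \<Longrightarrow> b \<in> B \<Longrightarrow> e a b = d a b" for A B e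
  proof -
    note A = nonempty_compactsD[OF AB(1)] and B = nonempty_compactsD[OF AB(2)]
    have inf: "(INF b\<in>B. e a b) \<le> s \<longleftrightarrow> (\<exists>b\<in>B. d a b \<le> s)" if a: "a \<in> A" for a s
    proof -
      obtain b where b: "b \<in> B" "\<And>b'. b' \<in> B \<Longrightarrow> d a b \<le> d a b'"
        using compactin_attains_mdist B a A(3) by (metis subsetD)
      have "(INF b\<in>B. e a b) = d a b"
        using b e[OF a] by (intro cInf_eq_minimum) auto
      then show ?thesis using b order_trans by (metis order_refl)
    qed
    obtain b0 where b0: "b0 \<in> B" using B(2) by blast
    obtain R where "\<And>a. a \<in> A \<Longrightarrow> d b0 a \<le> R"
    proof -
      have "mbounded A" using A(1) by (rule compactin_imp_mbounded)
      then obtain c s where "A \<subseteq> mcball c s" unfolding mbounded_def by blast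
      then have "d b0 a \<le> d b0 c + s" if "a \<in> A" for a
        using that b0 B(3) triangle[of b0 c a] by fastforce
      then show thesis using that by blast
    qed
    then have "bdd_above ((\<lambda>a. INF b\<in>B. e a b) ` A)"
      using inf b0 by (intro bdd_aboveI[of _ R]) (auto simp: commute)
    then show ?thesis using A(2) inf e by (simp add: cSUP_le_iff)
  qed
  show ?thesis
    unfolding hausdorff_dist_def hausdorff_within_def
    using *[OF A B, of d] *[OF B A, of "\<lambda>b a. d a b"] by (simp add: commute)
qed

text \<open>The axioms of \<^locale>\<open>Metric_space\<close> demand nonnegativity for arbitrary arguments, but on
  empty or unbounded sets the suprema and infima have unspecified values; hence the value 0 there.\<close>

definition hdist :: "'a set \<Rightarrow> 'a set \<Rightarrow> real" where
  "hdist A B = (if A \<in> nonempty_compacts M d \<and> B \<in> nonempty_compacts M d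
    then hausdorff_dist d A B else 0)"

lemma hdist_le_iff:
  assumes "A \<in> nonempty_compacts M d" "B \<in> nonempty_compacts M d"
  shows "hdist A B \<le> r \<longleftrightarrow> hausdorff_within d r A B"
  using assms by (simp add: hdist_def hausdorff_dist_le_iff)

lemma hausdorff_within_commute: "hausdorff_within d r A B \<longleftrightarrow> hausdorff_within d r B A"
  by (auto simp: hausdorff_within_def commute)

lemma hausdorff_within_triangle:
  assumes "hausdorff_within d r A B" "hausdorff_within d s B C" "A \<subseteq> M" "B \<subseteq> M" "C \<subseteq> M"
  shows "hausdorff_within d (r + s) A C"
proof -
  have half: "\<forall>a\<in>A. \<exists>c\<in>C. d a c \<le> r + s"
    if close: "hausdorff_within d r A B" "hausdorff_within d s B C"
      and sub: "A \<subseteq> M" "B \<subseteq> M" "C \<subseteq> M" for A B C r s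
  proof
    fix a assume a: "a \<in> A"
    then obtain b where b: "b \<in> B" "d a b \<le> r" using close(1) unfolding hausdorff_within_def by blast
    then obtain c where c: "c \<in> C" "d b c \<le> s" using close(2) unfolding hausdorff_within_def by blast
    have "d a c \<le> d a b + d b c" using a b c sub by (intro triangle) auto
    then show "\<exists>c\<in>C. d a c \<le> r + s" using b c by force
  qed
  have "\<forall>c\<in>C. \<exists>a\<in>A. d c a \<le> s + r"
    using half[of s C B r A] assms hausdorff_within_commute by blast
  then show ?thesis
    using half[OF assms] unfolding hausdorff_within_def by (simp add: commute add.commute)
qed

lemma Metric_space_hdist: "Metric_space (nonempty_compacts M d) hdist"
proof
  let ?H = "nonempty_compacts M d"
  have nonneg: "0 \<le> hdist A B" for A B
  proof (cases "A \<in> ?H \<and> B \<in> ?H")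
    case True
    then have "hausdorff_within d (hdist A B) A B" using hdist_le_iff by blast
    moreover obtain a where "a \<in> A" using True nonempty_compactsD(2) by blast
    ultimately show ?thesis
      unfolding hausdorff_within_def by (meson nonneg order_trans)
  qed (auto simp: hdist_def)
  then show "0 \<le> hdist A B" for A B .
  show "hdist A B = hdist B A" for A B
  proof (cases "A \<in> ?H \<and> B \<in> ?H")
    case True
    then have "hdist A B \<le> r \<longleftrightarrow> hdist B A \<le> r" for r
      using hdist_le_iff hausdorff_within_commute by blast
    then show ?thesis by (metis order_antisym order_refl)
  qed (auto simp: hdist_def)
  show "hdist A B = 0 \<longleftrightarrow> A = B" if AB: "A \<in> ?H" "B \<in> ?H" for A B
  proof -
    have sub: "A \<subseteq> M" "B \<subseteq> M" using AB nonempty_compactsD(3) by blast+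
    have "hdist A B = 0 \<longleftrightarrow> hausdorff_within d 0 A B"
      using nonneg hdist_le_iff[OF AB] by (metis order_antisym order_refl)
    also have "\<dots> \<longleftrightarrow> (\<forall>a\<in>A. \<exists>b\<in>B. a = b) \<and> (\<forall>b\<in>B. \<exists>a\<in>A. a = b)"
    proof -
      have "d a b \<le> 0 \<longleftrightarrow> a = b" if "a \<in> A" "b \<in> B" for a b
        using that sub by (metis Metric_space.mdist_zero Metric_space_axioms Metric_space.nonneg order_antisym order_refl subsetD zero)
      then show ?thesis unfolding hausdorff_within_def by blast
    qed
    finally show ?thesis by blast
  qed
  show "hdist A C \<le> hdist A B + hdist B C" if "A \<in> ?H" "B \<in> ?H" "C \<in> ?H" for A B C
    using that hdist_le_iff nonempty_compactsD(3) hausdorff_within_triangle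
    by (metis order_refl)
qed

text \<open>The nonempty subsets of a finite net form a finite net.\<close>

lemma nonempty_compacts_mtotally_bounded:
  assumes Z: "mtotally_bounded Z"
  shows "Metric_space.mtotally_bounded (nonempty_compacts M d) hdist
           {A \<in> nonempty_compacts M d. A \<subseteq> Z}"
proof -
  let ?H = "nonempty_compacts M d"
  interpret hyper: Metric_space ?H hdist by (rule Metric_space_hdist)
  show ?thesis
    unfolding hyper.mtotally_bounded_def
  proof (intro allI impI)
    fix \<epsilon> :: real assume \<epsilon>: "\<epsilon> > 0"
    then obtain N where N: "finite N" "N \<subseteq> Z" "Z \<subseteq> (\<Union>x\<in>N. mball x (\<epsilon>/2))"
      using Z unfolding mtotally_bounded_def by (meson half_gt_zero)
    have NM: "N \<subseteq> M" using N(2) Z mtotally_bounded_imp_subset by blast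
    let ?K = "{F. F \<subseteq> N \<and> F \<noteq> {}}"
    have KH: "?K \<subseteq> {A \<in> ?H. A \<subseteq> Z}"
      using N NM by (auto simp: nonempty_compacts_def intro!: finite_imp_compactin dest: finite_subset)
    have "\<exists>F\<in>?K. A \<in> hyper.mball F \<epsilon>" if A: "A \<in> ?H" "A \<subseteq> Z" for A
    proof -
      define F where "F = {x \<in> N. \<exists>a\<in>A. d x a \<le> \<epsilon>/2}"
      have close: "\<exists>x\<in>F. d x a \<le> \<epsilon>/2" if a: "a \<in> A" for a
      proof -
        obtain x where "x \<in> N" "a \<in> mball x (\<epsilon>/2)" using a A(2) N(3) by blast
        then show ?thesis using a unfolding F_def by (intro bexI[of _ x]) (auto intro!: bexI[of _ a])
      qed
      have "F \<noteq> {}" using close nonempty_compactsD(2)[OF A(1)] by blast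
      then have F: "F \<in> ?K" by (auto simp: F_def)
      then have FH: "F \<in> ?H" using KH by blast
      have "hausdorff_within d (\<epsilon>/2) F A"
        using close by (auto simp: hausdorff_within_def F_def)
      then have "hdist F A \<le> \<epsilon>/2"
        using A(1) FH hdist_le_iff by blast
      then have "hdist F A < \<epsilon>" using \<epsilon> by linarith
      then show ?thesis using F FH A(1) by (intro bexI[of _ F]) auto
    qed
    then show "\<exists>K. finite K \<and> K \<subseteq> {A \<in> ?H. A \<subseteq> Z} \<and> {A \<in> ?H. A \<subseteq> Z} \<subseteq> (\<Union>x\<in>K. hyper.mball x \<epsilon>)"
      using N(1) KH by (intro exI[of _ ?K]) auto
  qed
qed

text \<open>The limit \<open>L\<close> of a Cauchy sequence of sets consists of the points whose distance to the
  sets tends to 0; by the Cauchy property it suffices that the distance is small infinitely often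
  (\<open>limit_in_L\<close>). That every set of late index is close to this limit uses compactness: a point of it has nearby
  points in all later sets, and these accumulate.\<close>

lemma nonempty_compacts_complete:
  assumes Z: "compactin mtopology Z"
    and \<sigma>: "Metric_space.MCauchy (nonempty_compacts M d) hdist \<sigma>" "\<And>n. \<sigma> n \<subseteq> Z"
  obtains L where "L \<in> nonempty_compacts M d" "L \<subseteq> Z"
    "limitin (Metric_space.mtopology (nonempty_compacts M d) hdist) \<sigma> L sequentially"
proof -
  let ?H = "nonempty_compacts M d"
  interpret hyper: Metric_space ?H hdist by (rule Metric_space_hdist)
  have ZM: "Z \<subseteq> M" using Z compactin_subset_topspace by fastforce
  have H: "\<sigma> n \<in> ?H" for n using \<sigma>(1) unfolding hyper.MCauchy_def by blast
  have cauchy: "\<exists>N. \<forall>m\<ge>N. \<forall>n\<ge>N. hausdorff_within d \<epsilon> (\<sigma> m) (\<sigma> n)" if "\<epsilon> > 0" for \<epsilon>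
    using \<sigma>(1) that H hdist_le_iff unfolding hyper.MCauchy_def by (meson order_less_imp_le)
  define L where "L = {z \<in> Z. \<forall>\<epsilon>>0. \<exists>N. \<forall>n\<ge>N. \<exists>a\<in>\<sigma> n. d z a \<le> \<epsilon>}"
  have L_limit: "\<exists>N. \<forall>n\<ge>N. \<exists>a\<in>\<sigma> n. d z a \<le> \<epsilon>" if "z \<in> L" "\<epsilon> > 0" for z \<epsilon>
    using that by (simp add: L_def)
  have limit_in_L: "z \<in> L"
    if z: "z \<in> Z" "\<And>\<epsilon> N. \<epsilon> > 0 \<Longrightarrow> \<exists>m\<ge>N. \<exists>a\<in>\<sigma> m. d z a \<le> \<epsilon>" for z
    unfolding L_def
  proof (intro CollectI conjI allI impI z(1))
    fix \<epsilon> :: real assume "\<epsilon> > 0"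
    then obtain N where N: "\<And>m n. m \<ge> N \<Longrightarrow> n \<ge> N \<Longrightarrow> hausdorff_within d (\<epsilon>/2) (\<sigma> m) (\<sigma> n)"
      using cauchy[of "\<epsilon>/2"] by auto
    obtain m a where m: "m \<ge> N" "a \<in> \<sigma> m" "d z a \<le> \<epsilon>/2"
      using z(2)[of "\<epsilon>/2" N] \<open>\<epsilon> > 0\<close> by auto
    have "\<exists>b\<in>\<sigma> n. d z b \<le> \<epsilon>" if n: "n \<ge> N" for n
    proof -
      obtain b where b: "b \<in> \<sigma> n" "d a b \<le> \<epsilon>/2"
        using N[of m n] m(1,2) n unfolding hausdorff_within_def by blast
      have "d z b \<le> d z a + d a b"
        using z(1) m(2) b(1) \<sigma>(2) ZM by (intro triangle) blast+
      then show ?thesis using b m by force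
    qed
    then show "\<exists>N. \<forall>n\<ge>N. \<exists>b\<in>\<sigma> n. d z b \<le> \<epsilon>" by blast
  qed
  have near_L: "\<exists>z\<in>L. d a z \<le> 2 * \<epsilon>"
    if \<epsilon>: "\<epsilon> > 0" and N: "\<And>m n. m \<ge> N \<Longrightarrow> n \<ge> N \<Longrightarrow> hausdorff_within d \<epsilon> (\<sigma> m) (\<sigma> n)"
      and a: "n \<ge> N" "a \<in> \<sigma> n" for a n N \<epsilon>
  proof -
    have "\<exists>b\<in>\<sigma> (N + m). d a b \<le> \<epsilon>" for m
      using N[of n "N + m"] a by (auto simp: hausdorff_within_def)
    then obtain b where b: "\<And>m. b m \<in> \<sigma> (N + m)" "\<And>m. d a (b m) \<le> \<epsilon>" by metis
    have "range b \<subseteq> Z" using b(1) \<sigma>(2) by blast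
    then obtain z r where z: "z \<in> Z" "strict_mono r" "limitin mtopology (b \<circ> r) z sequentially"
      using Z unfolding compactin_sequentially by blast
    have lim: "\<exists>K. \<forall>j\<ge>K. d (b (r j)) z \<le> e" if "e > 0" for e
      using z(3) that unfolding limit_metric_sequentially o_def by (meson order_less_imp_le)
    have "z \<in> L"
    proof (rule limit_in_L[OF z(1)])
      fix e :: real and N' assume "e > 0"
      then obtain K where "\<forall>j\<ge>K. d (b (r j)) z \<le> e" using lim by blast
      then have "d z (b (r (max K N'))) \<le> e" by (simp add: commute)
      moreover have "N + r (max K N') \<ge> N'"
        using strict_mono_imp_increasing[OF z(2), of "max K N'"] by linarith
      ultimately show "\<exists>m\<ge>N'. \<exists>a\<in>\<sigma> m. d z a \<le> e" using b(1) by blast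
    qed
    moreover obtain j where "d (b (r j)) z \<le> \<epsilon>" using lim[OF \<epsilon>] by blast
    then have "d a z \<le> 2 * \<epsilon>"
      using triangle[of a "b (r j)" z] b(2)[of "r j"] a(2) b(1)[of "r j"] z(1) \<sigma>(2) ZM by fastforce
    ultimately show ?thesis by blast
  qed
  have closed: "closedin mtopology L"
    unfolding closedin_metric
  proof (intro conjI allI impI)
    show "L \<subseteq> M" using ZM by (auto simp: L_def)
    fix x assume x: "x \<in> M - L"
    show "\<exists>r>0. disjnt L (mball x r)"
    proof (rule ccontr)
      assume neg: "\<not> ?thesis"
      have close: "\<exists>z\<in>L. d x z < r" if "r > 0" for r
        using neg that by (auto simp: disjnt_iff)
      have "closedin mtopology Z" using Z compactin_imp_closedin Hausdorff_space_mtopology by blast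
      moreover have "\<not> disjnt Z (mball x r)" if r: "r > 0" for r
      proof -
        obtain z where "z \<in> L" "d x z < r" using close[OF r] by blast
        then show ?thesis using x ZM unfolding disjnt_iff L_def by auto
      qed
      ultimately have "x \<in> Z" using x unfolding closedin_metric by (metis DiffD1 DiffI)
      moreover have "\<exists>m\<ge>N. \<exists>a\<in>\<sigma> m. d x a \<le> \<epsilon>" if \<epsilon>: "\<epsilon> > 0" for \<epsilon> N
      proof -
        obtain z where z: "z \<in> L" "d x z < \<epsilon>/2" using close[of "\<epsilon>/2"] \<epsilon> by auto
        then obtain N' where "\<forall>n\<ge>N'. \<exists>a\<in>\<sigma> n. d z a \<le> \<epsilon>/2"
          using L_limit[OF z(1) half_gt_zero[OF \<epsilon>]] by blast
        then obtain a where a: "a \<in> \<sigma> (max N N')" "d z a \<le> \<epsilon>/2" by (meson max.cobounded2)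
        have "d x a \<le> d x z + d z a"
          using x z a \<sigma>(2) ZM by (intro triangle) (auto simp: L_def)
        then have "d x a \<le> \<epsilon>" using z a by simp
        then show ?thesis using a(1) max.cobounded1 by blast
      qed
      ultimately have "x \<in> L" by (rule limit_in_L)
      then show False using x by simp
    qed
  qed
  have "L \<noteq> {}"
  proof -
    obtain N where N: "\<And>m n. m \<ge> N \<Longrightarrow> n \<ge> N \<Longrightarrow> hausdorff_within d 1 (\<sigma> m) (\<sigma> n)"
      using cauchy[of 1] by auto
    obtain a where "a \<in> \<sigma> N" using nonempty_compactsD(2)[OF H] by blast
    with near_L[of 1 N N a] N show ?thesis by auto
  qed
  then have L: "L \<in> ?H"
    using closed closed_compactin[OF Z _ closed] by (auto simp: L_def nonempty_compacts_def)
  have "limitin hyper.mtopology \<sigma> L sequentially"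
    unfolding hyper.limit_metric_sequentially
  proof (intro conjI allI impI L)
    fix \<epsilon> :: real assume \<epsilon>: "\<epsilon> > 0"
    then obtain N where N: "\<And>m n. m \<ge> N \<Longrightarrow> n \<ge> N \<Longrightarrow> hausdorff_within d (\<epsilon>/3) (\<sigma> m) (\<sigma> n)"
      using cauchy[of "\<epsilon>/3"] by auto
    have "hdist (\<sigma> n) L \<le> 2 * (\<epsilon>/3)" if n: "n \<ge> N" for n
      unfolding hdist_le_iff[OF H L] hausdorff_within_def
    proof (intro conjI ballI)
      fix a assume "a \<in> \<sigma> n"
      then show "\<exists>z\<in>L. d a z \<le> 2 * (\<epsilon>/3)"
        using near_L[of "\<epsilon>/3" N n a] N n \<epsilon> by simp
    next
      fix z assume z: "z \<in> L"
      then obtain N' where "\<forall>n\<ge>N'. \<exists>a\<in>\<sigma> n. d z a \<le> \<epsilon>/3"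
        using L_limit[of z "\<epsilon>/3"] \<epsilon> by auto
      then obtain a where a: "a \<in> \<sigma> (max N N')" "d z a \<le> \<epsilon>/3" by (meson max.cobounded2)
      then obtain b where b: "b \<in> \<sigma> n" "d a b \<le> \<epsilon>/3"
        using N[of "max N N'" n] n by (auto simp: hausdorff_within_def)
      have "d z b \<le> d z a + d a b"
        using z a b \<sigma>(2) ZM by (intro triangle) (auto simp: L_def)
      then show "\<exists>b\<in>\<sigma> n. d b z \<le> 2 * (\<epsilon>/3)" using a b by (intro bexI[of _ b]) (auto simp: commute)
    qed
    then have "hdist (\<sigma> n) L < \<epsilon>" if "n \<ge> N" for n using that \<epsilon> by fastforce
    then show "\<exists>N. \<forall>n\<ge>N. \<sigma> n \<in> ?H \<and> hdist (\<sigma> n) L < \<epsilon>" using H by blast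
  qed
  moreover have "L \<subseteq> Z" by (auto simp: L_def)
  ultimately show thesis using that L by blast
qed

theorem compactin_nonempty_compacts:
  assumes Z: "compactin mtopology Z"
  shows "compactin (Metric_space.mtopology (nonempty_compacts M d) hdist)
           {A \<in> nonempty_compacts M d. A \<subseteq> Z}"
proof -
  let ?H = "nonempty_compacts M d"
  interpret hyper: Metric_space ?H hdist by (rule Metric_space_hdist)
  have tb: "hyper.mtotally_bounded {A \<in> ?H. A \<subseteq> Z}"
    using Z by (intro nonempty_compacts_mtotally_bounded compactin_imp_mtotally_bounded)
  show ?thesis
    unfolding hyper.compactin_sequentially
  proof (intro conjI allI impI)
    fix \<sigma> :: "nat \<Rightarrow> 'a set" assume \<sigma>: "range \<sigma> \<subseteq> {A \<in> ?H. A \<subseteq> Z}"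
    then obtain r where r: "strict_mono r" "hyper.MCauchy (\<sigma> \<circ> r)"
      using tb unfolding hyper.mtotally_bounded_sequentially by blast
    have "(\<sigma> \<circ> r) n \<subseteq> Z" for n using \<sigma> by auto
    then obtain L where "L \<in> ?H" "L \<subseteq> Z" "limitin hyper.mtopology (\<sigma> \<circ> r) L sequentially"
      using nonempty_compacts_complete[OF Z r(2)] by blast
    then show "\<exists>l r. l \<in> {A \<in> ?H. A \<subseteq> Z} \<and> strict_mono r
        \<and> limitin hyper.mtopology (\<sigma> \<circ> r) l sequentially"
      using r(1) by blast
  qed auto
qed

lemma isometry_nonempty_compacts:
  assumes s: "bij_betw s M M" and iso: "\<And>x y. x \<in> M \<Longrightarrow> y \<in> M \<Longrightarrow> d (s x) (s y) = d x y"
  shows "bij_betw ((`) s) (nonempty_compacts M d) (nonempty_compacts M d)"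
    and "\<And>A B. A \<in> nonempty_compacts M d \<Longrightarrow> B \<in> nonempty_compacts M d \<Longrightarrow>
           hdist (s ` A) (s ` B) = hdist A B"
proof -
  let ?H = "nonempty_compacts M d"
  have in_H: "t ` A \<in> ?H"
    if t: "t \<in> M \<rightarrow> M" "\<And>x y. x \<in> M \<Longrightarrow> y \<in> M \<Longrightarrow> d (t x) (t y) \<le> d x y" and A: "A \<in> ?H" for t A
  proof -
    have "continuous_map mtopology mtopology t"
      using nonexpansive_imp_continuous_map[OF Metric_space_axioms Metric_space_axioms t] by blast
    then show ?thesis using A image_compactin unfolding nonempty_compacts_def by blast
  qed
  have sM: "s \<in> M \<rightarrow> M" and inj: "inj_on s M" using s by (auto simp: bij_betw_def)
  have sH: "s ` A \<in> ?H" if "A \<in> ?H" for A using in_H[of s A] sM iso that by auto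
  define t where "t = inv_into M s"
  have t: "t x \<in> M" "s (t x) = x" if "x \<in> M" for x
    using that s unfolding t_def bij_betw_def by (metis inv_into_into, metis f_inv_into_f)
  have tH: "t ` A \<in> ?H" if "A \<in> ?H" for A
    using in_H[of t A] t iso that by (metis Pi_I order_refl)
  show "bij_betw ((`) s) ?H ?H"
    unfolding bij_betw_def
  proof
    show "inj_on ((`) s) ?H"
      using inj_on_image_eq_iff[OF inj] nonempty_compactsD(3) by (auto intro!: inj_onI)
    have "A \<in> (`) s ` ?H" if A: "A \<in> ?H" for A
    proof -
      have "s ` (t ` A) = A" using t(2) nonempty_compactsD(3)[OF A] by (force simp: image_image)
      then show ?thesis using tH[OF A] by (metis imageI)
    qed
    then show "(`) s ` ?H = ?H" using sH by blast
  qed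
  show "hdist (s ` A) (s ` B) = hdist A B" if AB: "A \<in> ?H" "B \<in> ?H" for A B
  proof -
    have "d (s a) (s b) = d a b" if "a \<in> A" "b \<in> B" for a b
      using iso AB that nonempty_compactsD(3) by blast
    then have "hausdorff_within d r (s ` A) (s ` B) \<longleftrightarrow> hausdorff_within d r A B" for r
      by (simp add: hausdorff_within_def)
    then have "hdist (s ` A) (s ` B) \<le> r \<longleftrightarrow> hdist A B \<le> r" for r
      using hdist_le_iff AB sH by simp
    then show ?thesis by (metis order_antisym order_refl)
  qed
qed

end

section \<open>Nonexpansive bijections of the finite vertex sets of a regular graph\<close>

lemma card_Pow_minus_empty: "finite A \<Longrightarrow> card (Pow A - {{}}) = 2 ^ card A - 1"
  by (simp add: card_Diff_singleton card_Pow)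

text \<open>The properties of the path metric of a connected \<open>k\<close>-regular graph that the argument uses.
  In the second axiom, a point at distance at most \<open>n + 1\<close> is reached in one step from a point at
  distance at most \<open>n\<close>; the third counts a vertex with its neighbours, and also yields local
  finiteness, since infinite sets have cardinality 0.\<close>

locale regular_graph_metric = Metric_space V \<rho> for V :: "'v set" and \<rho> +
  fixes k :: nat
  assumes dist_nat: "x \<in> V \<Longrightarrow> y \<in> V \<Longrightarrow> \<exists>n::nat. \<rho> x y = real n"
    and geodesic: "x \<in> V \<Longrightarrow> y \<in> V \<Longrightarrow> \<rho> x y \<le> real (Suc n) \<Longrightarrow> \<exists>z\<in>V. \<rho> x z \<le> real n \<and> \<rho> z y \<le> 1"
    and card_nbhd: "x \<in> V \<Longrightarrow> card {y \<in> V. \<rho> x y \<le> 1} = Suc k"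
begin

definition nbhd :: "'v \<Rightarrow> 'v set" where
  "nbhd x = {y \<in> V. \<rho> x y \<le> 1}"

definition finite_sets :: "'v set set" where
  "finite_sets = {F. finite F \<and> F \<noteq> {} \<and> F \<subseteq> V}"

lemma nbhd_sub: "nbhd x \<subseteq> V"
  by (auto simp: nbhd_def)

lemma card_closed_nbhd: "x \<in> V \<Longrightarrow> card (nbhd x) = Suc k"
  by (simp add: nbhd_def card_nbhd)

lemma finite_nbhd: "x \<in> V \<Longrightarrow> finite (nbhd x)"
  using card_closed_nbhd card.infinite by fastforce

lemma self_in_nbhd: "x \<in> V \<Longrightarrow> x \<in> nbhd x"
  by (simp add: nbhd_def)

lemma nbhd_sym: "x \<in> V \<Longrightarrow> y \<in> nbhd x \<Longrightarrow> x \<in> nbhd y"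
  by (simp add: nbhd_def commute)

lemma nbhd_subset_imp_eq: "x \<in> V \<Longrightarrow> y \<in> V \<Longrightarrow> nbhd x \<subseteq> nbhd y \<Longrightarrow> nbhd x = nbhd y"
  by (simp add: card_closed_nbhd card_subset_eq finite_nbhd)

lemma dist_nat_le: "x \<in> V \<Longrightarrow> y \<in> V \<Longrightarrow> \<exists>n. \<rho> x y \<le> real n"
  using dist_nat by fastforce

lemma dist_lt_1_imp_eq: "x \<in> V \<Longrightarrow> y \<in> V \<Longrightarrow> \<rho> x y < 1 \<Longrightarrow> x = y"
  using dist_nat zero by fastforce

lemma nbhd_closed_set_eq_vertices:
  assumes x: "x \<in> S" and S: "S \<subseteq> V" "\<And>y. y \<in> S \<Longrightarrow> nbhd y \<subseteq> S"
  shows "S = V"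
proof -
  have "y \<in> S" if "y \<in> V" "\<rho> x y \<le> real n" for n y
    using that
  proof (induct n arbitrary: y)
    case 0
    then show ?case using dist_lt_1_imp_eq[of x y] x S(1) by auto
  next
    case (Suc n)
    then obtain z where "z \<in> V" "\<rho> x z \<le> real n" "\<rho> z y \<le> 1" using geodesic x S(1) by blast
    then show ?case using Suc S(2)[of z] by (auto simp: nbhd_def)
  qed
  then show ?thesis using dist_nat_le x S(1) by blast
qed

lemma finite_cball: "x \<in> V \<Longrightarrow> finite {y \<in> V. \<rho> x y \<le> real n}"
proof (induct n)
  case 0
  have "{y \<in> V. \<rho> x y \<le> real 0} \<subseteq> {x}" using dist_lt_1_imp_eq[OF 0] by force
  then show ?case using finite_subset by blast
next
  case (Suc n)
  have "{y \<in> V. \<rho> x y \<le> real (Suc n)} \<subseteq> (\<Union>z\<in>{z \<in> V. \<rho> x z \<le> real n}. nbhd z)"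
    using geodesic[OF Suc.prems] unfolding nbhd_def by blast
  then show ?case using Suc finite_nbhd by (auto intro: finite_subset)
qed

lemma countable_vertices: "countable V"
proof (cases "V = {}")
  case False
  then obtain x where x: "x \<in> V" by blast
  then have "V = (\<Union>n. {y \<in> V. \<rho> x y \<le> real n})" using dist_nat_le by blast
  moreover have "countable (\<Union>n. {y \<in> V. \<rho> x y \<le> real n})"
    using finite_cball[OF x] by (intro countable_UN) (auto intro: countable_finite)
  ultimately show ?thesis by simp
qed simp

lemma nbhd_map_nonexpansive:
  assumes g: "\<And>x. x \<in> V \<Longrightarrow> g x \<in> V" "\<And>x. x \<in> V \<Longrightarrow> g ` nbhd x \<subseteq> nbhd (g x)"
    and xy: "x \<in> V" "y \<in> V"
  shows "\<rho> (g x) (g y) \<le> \<rho> x y"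
proof -
  have "\<rho> (g x) (g y) \<le> real n" if "y \<in> V" "\<rho> x y \<le> real n" for n y
    using that
  proof (induct n arbitrary: y)
    case 0
    then show ?case using dist_lt_1_imp_eq[of x y] xy(1) g(1) by auto
  next
    case (Suc n)
    then obtain z where z: "z \<in> V" "\<rho> x z \<le> real n" "\<rho> z y \<le> 1" using geodesic xy(1) by blast
    then have "g y \<in> nbhd (g z)" using g(2)[OF z(1)] Suc.prems by (auto simp: nbhd_def)
    then show ?case
      using Suc.hyps[OF z(1,2)] triangle[of "g x" "g z" "g y"] g(1) xy(1) z(1) Suc.prems(1)
      by (simp add: nbhd_def)
  qed
  then show ?thesis using dist_nat[OF xy] xy(2) by fastforce
qed

text \<open>A path of positive length ending at \<open>y\<close> can be redirected in its last step to any twin of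
  \<open>y\<close>. For radius 0 this fails, which is why only balls of radius at least 1 are considered.\<close>

lemma twin_dist_le:
  assumes "nbhd y = nbhd z" "y \<in> V" "z \<in> V" "w \<in> V" "n \<ge> 1" "\<rho> y w \<le> real n"
  shows "\<rho> z w \<le> real n"
proof -
  obtain m where m: "n = Suc m" using assms(5) by (cases n) auto
  obtain u where u: "u \<in> V" "\<rho> w u \<le> real m" "\<rho> u y \<le> 1"
    using geodesic[of w y m] assms m by (auto simp: commute)
  then have "u \<in> nbhd z" using assms(1,2) by (auto simp: nbhd_def commute)
  then show ?thesis
    using triangle[of w u z] assms u m by (simp add: nbhd_def commute)
qed

definition ball_sets :: "'v set \<Rightarrow> 'v set set" where
  "ball_sets F = {F' \<in> finite_sets. hausdorff_within \<rho> 1 F F'}"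

definition twin_set :: "'v set \<Rightarrow> bool" where
  "twin_set F \<longleftrightarrow> (\<forall>x\<in>F. \<forall>y\<in>F. nbhd x = nbhd y)"

lemma ball_sets_iff:
  assumes F: "F \<in> finite_sets"
  shows "F' \<in> ball_sets F \<longleftrightarrow> F' \<noteq> {} \<and> F' \<subseteq> (\<Union>x\<in>F. nbhd x) \<and> (\<forall>x\<in>F. nbhd x \<inter> F' \<noteq> {})"
proof
  assume "F' \<in> ball_sets F"
  then show "F' \<noteq> {} \<and> F' \<subseteq> (\<Union>x\<in>F. nbhd x) \<and> (\<forall>x\<in>F. nbhd x \<inter> F' \<noteq> {})"
    using F unfolding ball_sets_def finite_sets_def hausdorff_within_def nbhd_def by blast
next
  assume R: "F' \<noteq> {} \<and> F' \<subseteq> (\<Union>x\<in>F. nbhd x) \<and> (\<forall>x\<in>F. nbhd x \<inter> F' \<noteq> {})"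
  have "finite (\<Union>x\<in>F. nbhd x)" using F finite_nbhd by (auto simp: finite_sets_def)
  then have "finite F'" using R finite_subset by blast
  moreover have "F' \<subseteq> V" using R nbhd_sub by blast
  ultimately show "F' \<in> ball_sets F"
    using R unfolding ball_sets_def finite_sets_def hausdorff_within_def nbhd_def by blast
qed

lemma finite_ball_sets:
  assumes F: "F \<in> finite_sets"
  shows "finite (ball_sets F)"
proof (rule finite_subset)
  show "ball_sets F \<subseteq> Pow (\<Union>x\<in>F. nbhd x)" using ball_sets_iff[OF F] by blast
  show "finite (Pow (\<Union>x\<in>F. nbhd x))" using F finite_nbhd by (auto simp: finite_sets_def)
qed

lemma ball_sets_twin:
  assumes F: "F \<in> finite_sets" "twin_set F" and x: "x \<in> F"
  shows "ball_sets F = Pow (nbhd x) - {{}}"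
proof -
  have all: "nbhd y = nbhd x" if "y \<in> F" for y using F(2) x that unfolding twin_set_def by blast
  have "(\<Union>y\<in>F. nbhd y) = (\<Union>y\<in>F. nbhd x)" using all by (intro SUP_cong) simp_all
  then have union: "(\<Union>y\<in>F. nbhd y) = nbhd x" using x by auto
  have hit: "(\<forall>y\<in>F. nbhd y \<inter> F' \<noteq> {}) \<longleftrightarrow> nbhd x \<inter> F' \<noteq> {}" for F'
    using all x by metis
  have "F' \<in> ball_sets F \<longleftrightarrow> F' \<noteq> {} \<and> F' \<subseteq> nbhd x \<and> nbhd x \<inter> F' \<noteq> {}" for F'
    unfolding ball_sets_iff[OF F(1)] union hit ..
  then show ?thesis by blast
qed

lemma trivial_nbhd_imp_eq:
  assumes "x \<in> V" "y \<in> V" "nbhd x = {x}"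
  shows "y = x"
  using nbhd_closed_set_eq_vertices[of x "{x}"] assms by auto

text \<open>Let \<open>U\<close> be the union of the neighbourhoods of the points of \<open>F\<close>, and \<open>v \<in> F\<close>. For every
  nonempty \<open>S \<subseteq> nbhd v\<close> the set \<open>S \<union> (U - nbhd v)\<close> lies in the 1-ball of \<open>F\<close>: the neighbourhood
  of a point of \<open>F\<close> either meets the second part or, by regularity, is equal to \<open>nbhd v\<close>. This
  accounts for \<open>2 ^ Suc k - 1\<close> sets. If \<open>U\<close> has a point \<open>w\<close> outside \<open>nbhd v\<close>, then \<open>U - {w}\<close> is
  one more.\<close>

lemma card_ball_sets_le_imp_twin:
  assumes F: "F \<in> finite_sets" and le: "card (ball_sets F) \<le> 2 ^ Suc k - 1"
  shows "twin_set F"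
proof -
  define U where "U = (\<Union>x\<in>F. nbhd x)"
  have FV: "F \<subseteq> V" using F by (simp add: finite_sets_def)
  have "U \<subseteq> nbhd v" if v: "v \<in> F" for v
  proof (rule ccontr)
    assume "\<not> ?thesis"
    then obtain w where w: "w \<in> U" "w \<notin> nbhd v" by blast
    have vV: "v \<in> V" "nbhd v \<subseteq> U" using v FV by (auto simp: U_def)
    define h where "h S = S \<union> (U - nbhd v)" for S
    have "inj_on h (Pow (nbhd v))"
    proof (rule inj_onI)
      fix S T assume "S \<in> Pow (nbhd v)" "T \<in> Pow (nbhd v)" "h S = h T"
      then show "S = T" unfolding h_def by blast
    qed
    then have "card (h ` (Pow (nbhd v) - {{}})) = card (Pow (nbhd v) - {{}})"
      by (intro card_image) (rule inj_on_subset, auto)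
    then have c: "card (h ` (Pow (nbhd v) - {{}})) = 2 ^ Suc k - 1"
      using vV by (simp only: card_Pow_minus_empty finite_nbhd card_closed_nbhd)
    have hB: "h ` (Pow (nbhd v) - {{}}) \<subseteq> ball_sets F"
    proof
      fix T assume "T \<in> h ` (Pow (nbhd v) - {{}})"
      then obtain S where S: "S \<subseteq> nbhd v" "S \<noteq> {}" "T = S \<union> (U - nbhd v)" by (auto simp: h_def)
      have "nbhd x \<inter> T \<noteq> {}" if x: "x \<in> F" for x
      proof (cases "nbhd x \<subseteq> nbhd v")
        case True
        then have "nbhd x = nbhd v" using nbhd_subset_imp_eq x vV FV by blast
        then show ?thesis using S by blast
      next
        case False
        then show ?thesis using x S(3) by (auto simp: U_def)
      qed
      moreover have "T \<noteq> {}" "T \<subseteq> U" using S vV by auto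
      ultimately show "T \<in> ball_sets F" using ball_sets_iff[OF F] by (simp add: U_def)
    qed
    have new: "U - {w} \<in> ball_sets F"
    proof -
      have "nbhd x \<inter> (U - {w}) \<noteq> {}" if x: "x \<in> F" for x
      proof
        \<comment> \<open>then \<open>x\<close> is an isolated vertex, so the connected graph has no second vertex \<open>v\<close>\<close>
        assume "nbhd x \<inter> (U - {w}) = {}"
        then have "nbhd x \<subseteq> {w}" using x by (auto simp: U_def)
        then have "nbhd x = {x}" "x = w" using self_in_nbhd x FV by blast+
        then have "v = w" using trivial_nbhd_imp_eq[of x v] x FV vV by blast
        then show False using w(2) self_in_nbhd vV by blast
      qed
      moreover have "U - {w} \<noteq> {}" using v self_in_nbhd[OF vV(1)] w(2) vV(2) by blast
      ultimately show ?thesis using ball_sets_iff[OF F] unfolding U_def by blast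
    qed
    have "U - {w} \<notin> h ` (Pow (nbhd v) - {{}})" using w by (auto simp: h_def)
    then have "h ` (Pow (nbhd v) - {{}}) \<subset> ball_sets F" using hB new by blast
    then have "2 ^ Suc k - 1 < card (ball_sets F)"
      using psubset_card_mono[OF finite_ball_sets[OF F]] c by metis
    then show False using le by simp
  qed
  then have "nbhd x \<subseteq> nbhd y" if "x \<in> F" "y \<in> F" for x y using that unfolding U_def by blast
  then show ?thesis unfolding twin_set_def by blast
qed

text \<open>By counting, the inverse \<open>\<psi>\<close> of \<open>\<phi>\<close> maps sets of twins to sets of twins and their 1-balls
  onto 1-balls (\<open>tw\<close>). For a set of twins the 1-ball consists of all nonempty subsets of the common
  neighbourhood, so \<open>\<psi>\<close> determines, with \<open>r x\<close> any element of \<open>\<psi> {x}\<close>, an injective map of twin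
  classes \<open>cl x \<mapsto> cl (r x)\<close> that preserves adjacency, and \<open>card (cl x) \<le> card (cl (r x))\<close> because
  \<open>\<psi>\<close> maps the nonempty subsets of the first class injectively to those of the second. Choosing
  injections between the classes gives an injective \<open>\<gamma>\<close> on vertices that maps \<open>nbhd x\<close> into
  \<open>nbhd (\<gamma> x)\<close>. By regularity it maps onto, so the image of \<open>\<gamma>\<close> is closed under taking neighbours,
  hence everything, and \<open>\<gamma>\<close> is an automorphism. As \<open>\<gamma> x\<close> is a twin of the points of \<open>\<psi> {x}\<close>, the
  sets within distance \<open>n \<ge> 1\<close> of \<open>{\<gamma> x}\<close> are within \<open>n\<close> of \<open>\<psi> {x}\<close>, so \<open>\<phi>\<close> takes them to sets
  within \<open>n\<close> of \<open>{x}\<close>; on the finite family of these sets an injection is a permutation.\<close>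

theorem vertex_automorphism:
  assumes \<phi>: "bij_betw \<phi> finite_sets finite_sets"
    and ne: "\<And>n F F'. F \<in> finite_sets \<Longrightarrow> F' \<in> finite_sets \<Longrightarrow>
               hausdorff_within \<rho> (real n) F F' \<Longrightarrow> hausdorff_within \<rho> (real n) (\<phi> F) (\<phi> F')"
  obtains \<gamma> where "bij_betw \<gamma> V V" "\<And>x y. x \<in> V \<Longrightarrow> y \<in> V \<Longrightarrow> \<rho> (\<gamma> x) (\<gamma> y) = \<rho> x y"
    "\<And>x n. x \<in> V \<Longrightarrow> n \<ge> 1 \<Longrightarrow>
      (\<lambda>F. \<phi> (\<gamma> ` F)) ` (Pow {y \<in> V. \<rho> x y \<le> real n} - {{}}) = Pow {y \<in> V. \<rho> x y \<le> real n} - {{}}"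
proof -
  define \<psi> where "\<psi> = inv_into finite_sets \<phi>"
  have \<psi>: "\<psi> F \<in> finite_sets" "\<phi> (\<psi> F) = F" if "F \<in> finite_sets" for F
    using that \<phi> unfolding \<psi>_def bij_betw_def by (metis inv_into_into, metis f_inv_into_f)
  have \<phi>\<psi>: "\<psi> (\<phi> F) = F" if "F \<in> finite_sets" for F
    using that \<phi> by (simp add: \<psi>_def bij_betw_def)
  have \<phi>_in: "\<phi> F \<in> finite_sets" if "F \<in> finite_sets" for F
    using that \<phi> by (auto simp: bij_betw_def)
  have inj: "inj_on \<phi> finite_sets" using \<phi> by (simp add: bij_betw_def)
  have ballsub: "ball_sets F \<subseteq> finite_sets" for F by (auto simp: ball_sets_def)
  have ball_image: "\<phi> ` ball_sets F \<subseteq> ball_sets (\<phi> F)" if "F \<in> finite_sets" for F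
    using ne[of F _ 1] that \<phi>_in unfolding ball_sets_def by auto
  have ball_card: "card (\<phi> ` ball_sets F) = card (ball_sets F)" for F
    by (intro card_image inj_on_subset[OF inj] ballsub)
  have sub_twin: "twin_set {x}" for x by (simp add: twin_set_def)
  have tw: "twin_set (\<psi> F) \<and> \<phi> ` ball_sets (\<psi> F) = ball_sets F"
    if F: "F \<in> finite_sets" "twin_set F" for F
  proof -
    obtain x where x: "x \<in> F" "x \<in> V" using F(1) by (auto simp: finite_sets_def)
    have c: "card (ball_sets F) = 2 ^ Suc k - 1"
      using x by (simp only: ball_sets_twin[OF F x(1)] card_Pow_minus_empty finite_nbhd card_closed_nbhd)
    have sub: "\<phi> ` ball_sets (\<psi> F) \<subseteq> ball_sets F" using ball_image[of "\<psi> F"] \<psi> F by simp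
    have le: "card (ball_sets (\<psi> F)) \<le> card (ball_sets F)"
      using card_mono[OF finite_ball_sets[OF F(1)] sub] ball_card by simp
    then have t: "twin_set (\<psi> F)"
      using card_ball_sets_le_imp_twin \<psi>(1) F(1) c by simp
    obtain y where y: "y \<in> \<psi> F" "y \<in> V" using \<psi>(1)[OF F(1)] by (auto simp: finite_sets_def)
    have "card (ball_sets (\<psi> F)) = 2 ^ Suc k - 1"
      using y by (simp only: ball_sets_twin[OF \<psi>(1)[OF F(1)] t y(1)] card_Pow_minus_empty finite_nbhd card_closed_nbhd)
    then have "\<phi> ` ball_sets (\<psi> F) = ball_sets F"
      using sub c ball_card by (intro card_subset_eq finite_ball_sets F) simp_all
    with t show ?thesis by blast
  qed
  have sing: "{x} \<in> finite_sets" if "x \<in> V" for x using that by (simp add: finite_sets_def)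
  define r where "r x = (SOME y. y \<in> \<psi> {x})" for x
  have r\<psi>: "r x \<in> \<psi> {x}" if "x \<in> V" for x
  proof -
    have "\<psi> {x} \<noteq> {}" using \<psi>(1)[OF sing[OF that]] by (auto simp: finite_sets_def)
    then show ?thesis unfolding r_def by (simp add: some_in_eq)
  qed
  have rV: "r x \<in> V" if "x \<in> V" for x
    using r\<psi>[OF that] \<psi>(1)[OF sing[OF that]] by (auto simp: finite_sets_def)
  \<comment> \<open>the central identity: \<open>\<phi>\<close> carries the subsets of one neighbourhood to those of another\<close>
  have pow: "\<phi> ` (Pow (nbhd y) - {{}}) = Pow (nbhd x) - {{}}"
    if F: "F \<in> finite_sets" "twin_set F" "x \<in> F" "y \<in> \<psi> F" for F x y
    using tw[OF F(1,2)] ball_sets_twin[OF F(1,2,3)] ball_sets_twin[OF \<psi>(1)[OF F(1)] _ F(4)] by simp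
  have Pow_fin: "Pow (nbhd x) - {{}} \<subseteq> finite_sets" if "x \<in> V" for x
    using finite_nbhd[OF that] nbhd_sub finite_subset unfolding finite_sets_def by blast
  have Pow_eq: "A = B" if "Pow A - {{}} = Pow B - {{}}" "A \<noteq> {}" "B \<noteq> {}" for A B :: "'v set"
    using that by blast
  have nbhd_eq: "nbhd y = nbhd y' \<longleftrightarrow> nbhd x = nbhd x'"
    if "F \<in> finite_sets" "twin_set F" "x \<in> F" "y \<in> \<psi> F"
       "F' \<in> finite_sets" "twin_set F'" "x' \<in> F'" "y' \<in> \<psi> F'" for F x y F' x' y'
  proof -
    have V: "x \<in> V" "x' \<in> V" "y \<in> V" "y' \<in> V"
      using that \<psi>(1)[of F] \<psi>(1)[of F'] by (auto simp: finite_sets_def)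
    note p = pow[OF that(1-4)] pow[OF that(5-8)]
    show ?thesis
    proof
      assume "nbhd y = nbhd y'"
      then show "nbhd x = nbhd x'" using p Pow_eq self_in_nbhd V by (metis empty_iff)
    next
      assume "nbhd x = nbhd x'"
      then have "\<phi> ` (Pow (nbhd y) - {{}}) = \<phi> ` (Pow (nbhd y') - {{}})" using p by simp
      then have "Pow (nbhd y) - {{}} = Pow (nbhd y') - {{}}"
        using inj_on_image_eq_iff[OF inj Pow_fin[OF V(3)] Pow_fin[OF V(4)]] by simp
      then show "nbhd y = nbhd y'" using Pow_eq self_in_nbhd V by (metis empty_iff)
    qed
  qed
  have r_eq: "nbhd (r x) = nbhd (r y) \<longleftrightarrow> nbhd x = nbhd y" if "x \<in> V" "y \<in> V" for x y
    using nbhd_eq[OF sing sub_twin _ r\<psi> sing sub_twin _ r\<psi>] that by simp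
  have r_nbhd: "r y \<in> nbhd (r x)" if x: "x \<in> V" and y: "y \<in> nbhd x" for x y
  proof -
    have "y \<in> V" using y nbhd_sub by blast
    have "{y} \<in> \<phi> ` (Pow (nbhd (r x)) - {{}})"
      using pow[OF sing[OF x] sub_twin _ r\<psi>[OF x]] y by simp
    then obtain S where S: "S \<in> Pow (nbhd (r x)) - {{}}" "\<phi> S = {y}" by (metis imageE)
    have "S \<in> finite_sets" using S(1) Pow_fin[OF rV[OF x]] by blast
    then have "\<psi> {y} \<subseteq> nbhd (r x)" using \<phi>\<psi>[of S] S by auto
    then show ?thesis using r\<psi>[OF \<open>y \<in> V\<close>] by blast
  qed
  define cl where "cl x = {y \<in> V. nbhd y = nbhd x}" for x
  have cl_fin: "finite (cl x)" if "x \<in> V" for x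
  proof (rule finite_subset[OF _ finite_nbhd[OF that]])
    show "cl x \<subseteq> nbhd x" using self_in_nbhd by (auto simp: cl_def)
  qed
  have card_cl: "card (cl x) \<le> card (cl (r x))" if x: "x \<in> V" for x
  proof -
    have "\<psi> F \<in> Pow (cl (r x)) - {{}}" if F: "F \<in> Pow (cl x) - {{}}" for F
    proof -
      have Ff: "F \<in> finite_sets" "twin_set F"
        using F cl_fin[OF x] finite_subset[of F "cl x"] by (auto simp: finite_sets_def twin_set_def cl_def)
      obtain x' where x': "x' \<in> F" "nbhd x' = nbhd x" using F by (auto simp: cl_def)
      have "nbhd y = nbhd (r x)" if "y \<in> \<psi> F" for y
        using nbhd_eq[OF Ff x'(1) that sing[OF x] sub_twin _ r\<psi>[OF x]] x'(2) by simp
      then show ?thesis using \<psi>(1)[OF Ff(1)] by (auto simp: finite_sets_def cl_def)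
    qed
    then have sub: "\<psi> ` (Pow (cl x) - {{}}) \<subseteq> Pow (cl (r x)) - {{}}" by blast
    have "inj_on \<psi> finite_sets"
      using \<psi>(2) by (rule inj_on_inverseI)
    moreover have "Pow (cl x) - {{}} \<subseteq> finite_sets"
      using finite_subset[OF _ cl_fin[OF x]] by (auto simp: finite_sets_def cl_def)
    ultimately have "inj_on \<psi> (Pow (cl x) - {{}})"
      by (rule inj_on_subset)
    then have "card (Pow (cl x) - {{}}) \<le> card (Pow (cl (r x)) - {{}})"
      using sub cl_fin[OF rV[OF x]] by (intro card_inj_on_le) auto
    then have "(2::nat) ^ card (cl x) - 1 \<le> 2 ^ card (cl (r x)) - 1"
      using cl_fin x rV by (simp only: card_Pow_minus_empty)
    moreover have "(1::nat) \<le> 2 ^ card (cl x)" "(1::nat) \<le> 2 ^ card (cl (r x))" by simp_all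
    ultimately have "(2::nat) ^ card (cl x) \<le> 2 ^ card (cl (r x))" by linarith
    then show ?thesis by simp
  qed
  have cl_eq: "cl x = cl y" if "nbhd x = nbhd y" for x y using that by (simp add: cl_def)
  \<comment> \<open>the choice depends on the class only, so that \<open>\<gamma>\<close> below is injective on each class\<close>
  define h where "h c = (SOME h. inj_on h c \<and> (\<forall>x\<in>c. h ` c \<subseteq> cl (r x)))" for c
  have h: "inj_on (h (cl x)) (cl x) \<and> (\<forall>x'\<in>cl x. h (cl x) ` cl x \<subseteq> cl (r x'))" if x: "x \<in> V" for x
  proof -
    obtain g where g: "inj_on g (cl x)" "g ` cl x \<subseteq> cl (r x)"
      using card_le_inj[OF cl_fin[OF x] cl_fin[OF rV[OF x]] card_cl[OF x]] by blast
    moreover have "cl (r x') = cl (r x)" if "x' \<in> cl x" for x'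
      using that r_eq[of x' x] x cl_eq by (auto simp: cl_def)
    ultimately have "\<exists>h. inj_on h (cl x) \<and> (\<forall>x'\<in>cl x. h ` cl x \<subseteq> cl (r x'))" by blast
    from someI_ex[OF this] show ?thesis unfolding h_def .
  qed
  define \<gamma> where "\<gamma> x = h (cl x) x" for x
  have x_cl: "x \<in> cl x" if "x \<in> V" for x using that by (simp add: cl_def)
  have \<gamma>_cl: "\<gamma> x \<in> cl (r x)" if "x \<in> V" for x
    using h[OF that] x_cl[OF that] unfolding \<gamma>_def by blast
  have \<gamma>V: "\<gamma> x \<in> V" and \<gamma>r: "nbhd (\<gamma> x) = nbhd (r x)" if "x \<in> V" for x
    using \<gamma>_cl[OF that] by (auto simp: cl_def)
  have \<gamma>inj: "inj_on \<gamma> V"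
  proof (rule inj_onI)
    fix x y assume xy: "x \<in> V" "y \<in> V" "\<gamma> x = \<gamma> y"
    then have "nbhd x = nbhd y" using \<gamma>r r_eq by metis
    then have "cl x = cl y" by (rule cl_eq)
    then show "x = y" using h[OF xy(1)] xy x_cl unfolding \<gamma>_def by (metis inj_onD)
  qed
  have "\<gamma> ` nbhd x \<subseteq> nbhd (\<gamma> x)" if x: "x \<in> V" for x
  proof
    fix z assume "z \<in> \<gamma> ` nbhd x"
    then obtain y where y: "y \<in> nbhd x" "z = \<gamma> y" "y \<in> V" using nbhd_sub by blast
    have "r y \<in> nbhd (\<gamma> x)" using r_nbhd[OF x y(1)] \<gamma>r[OF x] by simp
    then have "\<gamma> x \<in> nbhd (r y)" using nbhd_sym \<gamma>V[OF x] by blast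
    then have "\<gamma> x \<in> nbhd (\<gamma> y)" using \<gamma>r y by simp
    then show "z \<in> nbhd (\<gamma> x)" using nbhd_sym \<gamma>V y by blast
  qed
  then have \<gamma>_nbhd: "\<gamma> ` nbhd x = nbhd (\<gamma> x)" if "x \<in> V" for x
    using that finite_nbhd \<gamma>V card_image[OF inj_on_subset[OF \<gamma>inj nbhd_sub]] card_closed_nbhd
    by (intro card_subset_eq) simp_all
  have \<gamma>surj: "\<gamma> ` V = V"
  proof (cases "V = {}")
    case False
    then obtain x where x: "x \<in> V" by blast
    show ?thesis
    proof (rule nbhd_closed_set_eq_vertices[of "\<gamma> x"])
      show "nbhd y \<subseteq> \<gamma> ` V" if "y \<in> \<gamma> ` V" for y
        using that \<gamma>_nbhd nbhd_sub by (metis imageE image_mono)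
    qed (use x \<gamma>V in auto)
  qed simp
  then have bij: "bij_betw \<gamma> V V" using \<gamma>inj by (simp add: bij_betw_def)
  define \<delta> where "\<delta> = inv_into V \<gamma>"
  have \<delta>: "\<delta> x \<in> V" "\<gamma> (\<delta> x) = x" if "x \<in> V" for x
    using that \<gamma>surj unfolding \<delta>_def by (metis inv_into_into, metis f_inv_into_f)
  have \<delta>\<gamma>: "\<delta> (\<gamma> x) = x" if "x \<in> V" for x using that \<gamma>inj by (simp add: \<delta>_def)
  have \<delta>_nbhd: "\<delta> ` nbhd x \<subseteq> nbhd (\<delta> x)" if "x \<in> V" for x
  proof -
    have "\<delta> ` nbhd x = \<delta> ` \<gamma> ` nbhd (\<delta> x)"
      using \<gamma>_nbhd[OF \<delta>(1)[OF that]] \<delta>(2)[OF that] by simp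
    also have "\<dots> \<subseteq> nbhd (\<delta> x)" using \<delta>\<gamma> subsetD[OF nbhd_sub] by auto
    finally show ?thesis .
  qed
  have iso: "\<rho> (\<gamma> x) (\<gamma> y) = \<rho> x y" if "x \<in> V" "y \<in> V" for x y
  proof (rule order_antisym)
    show "\<rho> (\<gamma> x) (\<gamma> y) \<le> \<rho> x y" using \<gamma>V \<gamma>_nbhd that by (intro nbhd_map_nonexpansive) auto
    show "\<rho> x y \<le> \<rho> (\<gamma> x) (\<gamma> y)"
      using nbhd_map_nonexpansive[of \<delta> "\<gamma> x" "\<gamma> y"] \<delta> \<delta>_nbhd that \<gamma>V \<delta>\<gamma> by simp
  qed
  have "(\<lambda>F. \<phi> (\<gamma> ` F)) ` (Pow {y \<in> V. \<rho> x y \<le> real n} - {{}}) = Pow {y \<in> V. \<rho> x y \<le> real n} - {{}}"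
    (is "?f ` ?Q = ?Q") if x: "x \<in> V" and n: "n \<ge> 1" for x n
  proof (rule endo_inj_surj)
    have Qfin: "F \<in> finite_sets" if "F \<in> ?Q" for F
      using that finite_subset[OF _ finite_cball[OF x, of n]] by (auto simp: finite_sets_def)
    show "finite ?Q" using finite_cball[OF x, of n] by simp
    have \<gamma>fin: "\<gamma> ` F \<in> finite_sets" if "F \<in> finite_sets" for F
      using that \<gamma>V by (auto simp: finite_sets_def)
    show "inj_on ?f ?Q"
    proof (rule inj_onI)
      fix F F' assume F: "F \<in> ?Q" "F' \<in> ?Q" "\<phi> (\<gamma> ` F) = \<phi> (\<gamma> ` F')"
      then have "\<gamma> ` F = \<gamma> ` F'" using inj_onD[OF inj] \<gamma>fin Qfin by simp
      moreover have "F \<subseteq> V" "F' \<subseteq> V" using F by auto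
      ultimately show "F = F'" using inj_on_image_eq_iff[OF \<gamma>inj] by simp
    qed
    show "?f ` ?Q \<subseteq> ?Q"
    proof
      fix G assume "G \<in> ?f ` ?Q"
      then obtain F where F: "F \<in> ?Q" "G = \<phi> (\<gamma> ` F)" by blast
      \<comment> \<open>\<open>\<gamma> x\<close> is within \<open>n\<close> of \<open>\<gamma> z\<close>, hence so is its twin \<open>y\<close>\<close>
      have near: "\<rho> y (\<gamma> z) \<le> real n" if y: "y \<in> \<psi> {x}" and z: "z \<in> F" for y z
      proof (rule twin_dist_le[where y = "\<gamma> x"])
        show "nbhd (\<gamma> x) = nbhd y"
          using nbhd_eq[OF sing[OF x] sub_twin _ y sing[OF x] sub_twin _ r\<psi>[OF x]] \<gamma>r[OF x] by simp
        show "y \<in> V" using y \<psi>(1)[OF sing[OF x]] by (auto simp: finite_sets_def)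
        show "\<rho> (\<gamma> x) (\<gamma> z) \<le> real n" using iso[OF x, of z] z F(1) by auto
      qed (use x n z F(1) \<gamma>V in auto)
      have F': "\<gamma> ` F \<in> finite_sets" using Qfin F(1) \<gamma>fin by blast
      have "hausdorff_within \<rho> (real n) (\<psi> {x}) (\<gamma> ` F)"
        using near F(1) r\<psi>[OF x] unfolding hausdorff_within_def by blast
      then have "hausdorff_within \<rho> (real n) {x} G"
        using ne[OF \<psi>(1)[OF sing[OF x]] F'] \<psi>(2)[OF sing[OF x]] F(2) by simp
      then show "G \<in> ?Q"
        using \<phi>_in[OF F'] F(2) by (auto simp: hausdorff_within_def finite_sets_def)
    qed
  qed
  then show thesis using that[OF bij] iso by blast
qed

end

section \<open>The hyperspace of a cylinder over a regular graph\<close>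

locale graph_cylinder = base: Metric_space K d + graph: regular_graph_metric V \<rho> k
  for K :: "'a set" and d and V :: "'v set" and \<rho> and k +
  assumes compact_base: "compact_space base.mtopology"
    and connected_base: "connected_space base.mtopology"
    and nonempty_base: "K \<noteq> {}"
begin

sublocale cyl: Metric_space "K \<times> V" "sup_dist d \<rho>"
  by (rule Metric_space_sup_dist) unfold_locales

abbreviation "D \<equiv> sup_dist d \<rho>"
abbreviation "H \<equiv> nonempty_compacts (K \<times> V) D"

sublocale hyper: Metric_space H cyl.hdist
  by (rule cyl.Metric_space_hdist)

lemma dist_snd_le: "\<rho> (snd p) (snd q) \<le> D p q"
  by (simp add: sup_dist_def split_beta)

lemma snd_eq_of_close:
  assumes "p \<in> K \<times> V" "q \<in> K \<times> V" "D p q < 1"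
  shows "snd p = snd q"
  using assms dist_snd_le[of p q] by (intro graph.dist_lt_1_imp_eq) auto

lemma finite_projection:
  assumes A: "A \<in> H"
  shows "snd ` A \<in> graph.finite_sets"
proof -
  note A' = cyl.nonempty_compactsD[OF A]
  obtain N where N: "finite N" "N \<subseteq> A" "A \<subseteq> (\<Union>x\<in>N. cyl.mball x 1)"
    using cyl.compactin_imp_mtotally_bounded[OF A'(1)] unfolding cyl.mtotally_bounded_def
    by (meson zero_less_one)
  have "snd p \<in> snd ` N" if p: "p \<in> A" for p
  proof -
    obtain q where q: "q \<in> N" "p \<in> cyl.mball q 1" using N(3) p by blast
    then have "snd q = snd p" by (intro snd_eq_of_close) auto
    then show ?thesis using q(1) by (metis image_eqI)
  qed
  then have "finite (snd ` A)" using N(1) by (meson finite_imageI finite_subset image_subsetI)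
  then show ?thesis using A'(2,3) by (auto simp: graph.finite_sets_def)
qed

lemma hausdorff_within_projection:
  assumes "hausdorff_within D r A B"
  shows "hausdorff_within \<rho> r (snd ` A) (snd ` B)"
proof -
  have "D p q \<le> r \<Longrightarrow> \<rho> (snd p) (snd q) \<le> r" for p q
    using dist_snd_le[of p q] by simp
  then show ?thesis using assms unfolding hausdorff_within_def by blast
qed

lemma projection_eq_of_close:
  assumes AB: "A \<in> H" "B \<in> H" "cyl.hdist A B < 1"
  shows "snd ` A = snd ` B"
proof -
  have "hausdorff_within \<rho> (cyl.hdist A B) (snd ` A) (snd ` B)"
    using AB cyl.hdist_le_iff hausdorff_within_projection by blast
  moreover have "u = v" if "u \<in> snd ` A" "v \<in> snd ` B" "\<rho> u v \<le> cyl.hdist A B" for u v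
    using that AB finite_projection[OF AB(1)] finite_projection[OF AB(2)]
    by (intro graph.dist_lt_1_imp_eq) (auto simp: graph.finite_sets_def)
  ultimately have "u \<in> snd ` B" "v \<in> snd ` A" if "u \<in> snd ` A" "v \<in> snd ` B" for u v
    using that unfolding hausdorff_within_def by metis+
  moreover have "snd ` A \<noteq> {}" "snd ` B \<noteq> {}" using AB cyl.nonempty_compactsD(2) by blast+
  ultimately show ?thesis by blast
qed

lemma compactin_slab:
  assumes F: "finite F" "F \<subseteq> V"
  shows "compactin cyl.mtopology (K \<times> F)"
proof -
  have "compactin cyl.mtopology (K \<times> {v})" if v: "v \<in> V" for v
  proof -
    have "continuous_map base.mtopology cyl.mtopology (\<lambda>x. (x, v))"
      using v by (intro nonexpansive_imp_continuous_map base.Metric_space_axioms cyl.Metric_space_axioms)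
        (auto simp: sup_dist_def)
    then have "compactin cyl.mtopology ((\<lambda>x. (x, v)) ` K)"
      using compact_base image_compactin by (metis base.topspace_mtopology compact_space_def)
    moreover have "(\<lambda>x. (x, v)) ` K = K \<times> {v}" by auto
    ultimately show ?thesis by simp
  qed
  then have "compactin cyl.mtopology (\<Union>v\<in>F. K \<times> {v})"
    using F by (intro compactin_Union) auto
  moreover have "(\<Union>v\<in>F. K \<times> {v}) = K \<times> F" by auto
  ultimately show ?thesis by simp
qed

definition layer :: "'v set \<Rightarrow> ('a \<times> 'v) set set" where
  "layer F = {A \<in> H. snd ` A = F}"

lemma slab_in_layer: "F \<in> graph.finite_sets \<Longrightarrow> K \<times> F \<in> layer F"
  using compactin_slab nonempty_base by (auto simp: layer_def nonempty_compacts_def graph.finite_sets_def)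

lemma layer_subset: "A \<in> layer F \<Longrightarrow> A \<subseteq> K \<times> F"
  using cyl.nonempty_compactsD(3) by (force simp: layer_def)

lemma compactin_layer:
  assumes F: "F \<in> graph.finite_sets"
  shows "compactin hyper.mtopology (layer F)"
proof (rule closed_compactin)
  show "compactin hyper.mtopology {A \<in> H. A \<subseteq> K \<times> F}"
    using F by (intro cyl.compactin_nonempty_compacts compactin_slab) (auto simp: graph.finite_sets_def)
  show "layer F \<subseteq> {A \<in> H. A \<subseteq> K \<times> F}"
    using layer_subset by (auto simp: layer_def)
  show "closedin hyper.mtopology (layer F)"
    unfolding hyper.closedin_metric
  proof (intro conjI allI impI)
    fix A assume A: "A \<in> H - layer F"
    have "B \<notin> hyper.mball A 1" if "B \<in> layer F" for B
      using projection_eq_of_close[of A B] A that by (auto simp: layer_def)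
    then have "disjnt (layer F) (hyper.mball A 1)" by (auto simp: disjnt_iff)
    then show "\<exists>r>0. disjnt (layer F) (hyper.mball A r)" by (meson zero_less_one)
  qed (auto simp: layer_def)
qed

definition thicken :: "real \<Rightarrow> ('a \<times> 'v) set \<Rightarrow> ('a \<times> 'v) set" where
  "thicken \<delta> A = {p \<in> K \<times> V. \<exists>a\<in>A. D p a \<le> \<delta>}"

lemma thicken_layer:
  assumes F: "F \<in> graph.finite_sets" and A: "A \<in> layer F" and \<delta>: "0 < \<delta>" "\<delta> < 1"
  shows "thicken \<delta> A \<in> layer F" "cyl.hdist A (thicken \<delta> A) \<le> \<delta>" "A \<subseteq> thicken \<delta> A"
proof -
  have AH: "A \<in> H" and AF: "snd ` A = F" using A by (auto simp: layer_def)
  note A' = cyl.nonempty_compactsD[OF AH]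
  show sub: "A \<subseteq> thicken \<delta> A"
  proof
    fix a assume a: "a \<in> A"
    then have "a \<in> K \<times> V" using A'(3) by blast
    moreover from this have "D a a \<le> \<delta>" using \<delta>(1) cyl.mdist_zero[of a] by simp
    ultimately show "a \<in> thicken \<delta> A" using a unfolding thicken_def by blast
  qed
  have "snd p \<in> F" if p: "p \<in> thicken \<delta> A" for p
  proof -
    obtain a where a: "a \<in> A" "p \<in> K \<times> V" "D p a \<le> \<delta>" using p by (auto simp: thicken_def)
    then have "snd p = snd a" using A'(3) \<delta>(2) by (intro snd_eq_of_close) auto
    then show ?thesis using a(1) AF by auto
  qed
  then have F': "thicken \<delta> A \<subseteq> K \<times> F" "snd ` thicken \<delta> A = F"
  proof -
    assume in_F: "\<And>p. p \<in> thicken \<delta> A \<Longrightarrow> snd p \<in> F"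
    show "thicken \<delta> A \<subseteq> K \<times> F"
    proof
      fix p assume p: "p \<in> thicken \<delta> A"
      then have "fst p \<in> K" by (auto simp: thicken_def)
      with in_F[OF p] show "p \<in> K \<times> F" by (simp add: mem_Times_iff)
    qed
    show "snd ` thicken \<delta> A = F" using in_F sub AF by blast
  qed
  have "closedin cyl.mtopology (thicken \<delta> A)"
    unfolding thicken_def by (rule cyl.closedin_thickening[OF A'(1)])
  moreover have "compactin cyl.mtopology (K \<times> F)"
    using F by (intro compactin_slab) (auto simp: graph.finite_sets_def)
  ultimately have "compactin cyl.mtopology (thicken \<delta> A)"
    using F'(1) closed_compactin by blast
  then have TH: "thicken \<delta> A \<in> H" using sub A'(2) by (auto simp: nonempty_compacts_def)
  then show "thicken \<delta> A \<in> layer F" using F'(2) by (simp add: layer_def)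
  have "\<exists>b\<in>thicken \<delta> A. D a b \<le> \<delta>" if "a \<in> A" for a
    using that sub A'(3) \<delta>(1) cyl.mdist_zero by (metis less_imp_le subsetD)
  then show "cyl.hdist A (thicken \<delta> A) \<le> \<delta>"
    unfolding cyl.hdist_le_iff[OF AH TH] hausdorff_within_def
    by (auto simp: thicken_def cyl.commute)
qed

lemma thicken_funpow_layer:
  assumes F: "F \<in> graph.finite_sets" and A: "A \<in> layer F" and \<delta>: "0 < \<delta>" "\<delta> < 1"
  shows "(thicken \<delta> ^^ j) A \<in> layer F"
  using A by (induct j) (auto intro: thicken_layer[OF F _ \<delta>])

text \<open>Within a fibre the points reached by the iterated thickenings form a clopen subset of the
  connected space \<open>K\<close>, so every point is reached; a finite \<open>\<delta>\<close>-net is then contained in some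
  iterate, and the next iterate is everything.\<close>

lemma thicken_exhausts:
  assumes F: "F \<in> graph.finite_sets" and A: "A \<in> layer F" and \<delta>: "0 < \<delta>" "\<delta> < 1"
  obtains j where "(thicken \<delta> ^^ j) A = K \<times> F"
proof -
  let ?T = "\<lambda>j. (thicken \<delta> ^^ j) A"
  have FV: "F \<subseteq> V" "finite F" using F by (auto simp: graph.finite_sets_def)
  have layer: "?T j \<in> layer F" for j by (rule thicken_funpow_layer[OF F A \<delta>])
  have mono: "?T i \<subseteq> ?T j" if "i \<le> j" for i j
    using that by (rule lift_Suc_mono_le[of ?T, rotated]) (use thicken_layer(3)[OF F layer \<delta>] in simp)
  have step: "p \<in> ?T (Suc j)" if "q \<in> ?T j" "p \<in> K \<times> V" "D p q \<le> \<delta>" for p q j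
    using that by (auto simp: thicken_def)
  have reach: "\<exists>j. (x, v) \<in> ?T j" if v: "v \<in> F" and x: "x \<in> K" for x v
  proof -
    define R where "R = {x \<in> K. \<exists>j. (x, v) \<in> ?T j}"
    have spread: "y \<in> R" if xR: "x \<in> R" and y: "y \<in> K" "d x y < \<delta>" for x y
    proof -
      obtain j where "(x, v) \<in> ?T j" using xR by (auto simp: R_def)
      moreover have "D (y, v) (x, v) \<le> \<delta>"
        using y(2) \<delta>(1) v FV by (simp add: sup_dist_def base.commute subsetD)
      ultimately have "(y, v) \<in> ?T (Suc j)" using y(1) v FV by (intro step) auto
      then show ?thesis using y(1) unfolding R_def by blast
    qed
    have "openin base.mtopology R"
      unfolding base.openin_mtopology using spread \<delta>(1) by (fastforce simp: R_def)
    moreover have "closedin base.mtopology R"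
      unfolding base.closedin_metric
    proof (intro conjI allI impI)
      fix y assume "y \<in> K - R"
      then have "disjnt R (base.mball y \<delta>)"
        using spread[of _ y] by (auto simp: disjnt_iff base.commute)
      then show "\<exists>r>0. disjnt R (base.mball y r)" using \<delta>(1) by blast
    qed (auto simp: R_def)
    moreover have "R \<noteq> {}"
    proof -
      obtain a where "a \<in> A" "snd a = v" using A v by (auto simp: layer_def)
      then have "fst a \<in> R" using layer_subset[OF A]
        by (auto simp: R_def intro!: exI[of _ 0])
      then show ?thesis by blast
    qed
    ultimately have "R = K"
      using connected_base unfolding connected_space_clopen_in by auto
    then show ?thesis using x by (auto simp: R_def)
  qed
  have "cyl.mtotally_bounded (K \<times> F)"
    using compactin_slab[OF FV(2,1)] by (rule cyl.compactin_imp_mtotally_bounded)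
  then have "\<exists>N. finite N \<and> N \<subseteq> K \<times> F \<and> K \<times> F \<subseteq> (\<Union>p\<in>N. cyl.mball p \<delta>)"
    using \<delta>(1) unfolding cyl.mtotally_bounded_def by simp
  then obtain N where N: "finite N" "N \<subseteq> K \<times> F" "K \<times> F \<subseteq> (\<Union>p\<in>N. cyl.mball p \<delta>)" by blast
  have "\<exists>j. p \<in> ?T j" if "p \<in> N" for p using reach that N(2) by (cases p) auto
  then obtain j where j: "\<And>p. p \<in> N \<Longrightarrow> p \<in> ?T (j p)" by metis
  define m where "m = Max (insert 0 (j ` N))"
  have "N \<subseteq> ?T m"
  proof
    fix p assume p: "p \<in> N"
    then have "j p \<le> m" using N(1) unfolding m_def by (intro Max_ge) auto
    then show "p \<in> ?T m" using j[OF p] mono by blast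
  qed
  have "p \<in> ?T (Suc m)" if p: "p \<in> K \<times> F" for p
  proof -
    obtain q where q: "q \<in> N" "p \<in> cyl.mball q \<delta>" using N(3) p by blast
    then show ?thesis
      using \<open>N \<subseteq> ?T m\<close> by (intro step[of q]) (auto simp: cyl.commute)
  qed
  then have "K \<times> F \<subseteq> ?T (Suc m)" by blast
  then show thesis using that[of "Suc m"] layer_subset[OF layer] by blast
qed

text \<open>Connectedness at scale \<open>\<epsilon>\<close>, phrased for predicates: every member of the layer is linked to
  \<open>K \<times> F\<close> by a chain of thickenings in steps smaller than \<open>\<epsilon>\<close>.\<close>

lemma layer_scale_connected:
  assumes F: "F \<in> graph.finite_sets" and \<epsilon>: "\<epsilon> > 0" and AB: "A \<in> layer F" "B \<in> layer F"
    and step: "\<And>A B. A \<in> layer F \<Longrightarrow> B \<in> layer F \<Longrightarrow> cyl.hdist A B < \<epsilon> \<Longrightarrow> P A \<Longrightarrow> P B"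
    and P: "P A"
  shows "P B"
proof -
  define \<delta> where "\<delta> = min (\<epsilon>/2) (1/2)"
  have \<delta>: "0 < \<delta>" "\<delta> < 1" "\<delta> < \<epsilon>" using \<epsilon> by (auto simp: \<delta>_def)
  have slab: "P A \<longleftrightarrow> P (K \<times> F)" if A: "A \<in> layer F" for A
  proof -
    have "P A \<longleftrightarrow> P ((thicken \<delta> ^^ j) A)" for j
    proof (induct j)
      case (Suc j)
      let ?T = "(thicken \<delta> ^^ j) A"
      have T: "?T \<in> layer F" by (rule thicken_funpow_layer[OF F A \<delta>(1,2)])
      note T' = thicken_layer[OF F T \<delta>(1,2)]
      have "cyl.hdist ?T (thicken \<delta> ?T) < \<epsilon>" using T'(2) \<delta>(3) by simp
      then have "P ?T \<longleftrightarrow> P (thicken \<delta> ?T)"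
        using step T T'(1) hyper.commute by metis
      then show ?case using Suc by simp
    qed simp
    then show ?thesis using thicken_exhausts[OF F A \<delta>(1,2)] by metis
  qed
  then show ?thesis using AB P by blast
qed

text \<open>By compactness, the two parts of a separation would have positive distance \<open>\<epsilon>\<close> (a Lebesgue
  number of the cover by their complements), and chains in steps smaller than \<open>\<epsilon>\<close> could not pass
  from one to the other.\<close>

lemma connectedin_layer:
  assumes F: "F \<in> graph.finite_sets"
  shows "connectedin hyper.mtopology (layer F)"
  unfolding connectedin_closedin
proof (intro conjI notI)
  show "layer F \<subseteq> topspace hyper.mtopology" by (auto simp: layer_def)
  assume "\<exists>E1 E2. closedin hyper.mtopology E1 \<and> closedin hyper.mtopology E2 \<and>
      layer F \<subseteq> E1 \<union> E2 \<and> E1 \<inter> E2 \<inter> layer F = {} \<and> E1 \<inter> layer F \<noteq> {} \<and> E2 \<inter> layer F \<noteq> {}"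
  then obtain E1 E2 A B where E: "closedin hyper.mtopology E1" "closedin hyper.mtopology E2"
      "layer F \<subseteq> E1 \<union> E2" "E1 \<inter> E2 \<inter> layer F = {}"
    and A: "A \<in> E1" "A \<in> layer F" and B: "B \<in> E2" "B \<in> layer F" by blast
  have HF: "layer F \<subseteq> H" by (auto simp: layer_def)
  have "\<exists>\<epsilon>>0. \<forall>C\<in>layer F. \<exists>U\<in>{H - E1, H - E2}. hyper.mball C \<epsilon> \<subseteq> U"
  proof (rule hyper.lebesgue_number[OF compactin_layer[OF F]])
    show "layer F \<subseteq> \<Union>{H - E1, H - E2}" using E(4) HF by blast
    show "openin hyper.mtopology U" if "U \<in> {H - E1, H - E2}" for U
      using that E(1,2) by (auto simp: closedin_def)
  qed
  then obtain \<epsilon> where \<epsilon>: "\<epsilon> > 0"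
      "\<And>C. C \<in> layer F \<Longrightarrow> hyper.mball C \<epsilon> \<subseteq> H - E1 \<or> hyper.mball C \<epsilon> \<subseteq> H - E2" by blast
  have "B \<in> E1"
  proof (rule layer_scale_connected[where P = "\<lambda>C. C \<in> E1", OF F \<epsilon>(1) A(2) B(2) _ A(1)])
    fix C C' assume C: "C \<in> layer F" "C' \<in> layer F" "cyl.hdist C C' < \<epsilon>" "C \<in> E1"
    then have "C \<in> hyper.mball C \<epsilon>" "C' \<in> hyper.mball C \<epsilon>" using HF \<epsilon>(1) by auto
    then show "C' \<in> E1" using \<epsilon>(2)[OF C(1)] C E(3) by blast
  qed
  then show False using B E(4) by blast
qed

context
  fixes f
  assumes f: "bij_betw f H H"
    and nonexp: "\<And>A B. A \<in> H \<Longrightarrow> B \<in> H \<Longrightarrow> cyl.hdist (f A) (f B) \<le> cyl.hdist A B"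
begin

text \<open>The map that \<open>f\<close> induces on finite vertex sets, computed on the representative \<open>K \<times> F\<close> of
  the layer; lemma \<open>projection_f\<close> shows that every representative gives the same set.\<close>

definition induced :: "'v set \<Rightarrow> 'v set" where
  "induced F = snd ` f (K \<times> F)"

lemma f_in: "A \<in> H \<Longrightarrow> f A \<in> H"
  using f by (auto simp: bij_betw_def)

text \<open>Steps shorter than 1 inside a layer are mapped to steps shorter than 1, which cannot change
  the projection.\<close>

lemma projection_f:
  assumes A: "A \<in> H"
  shows "snd ` f A = induced (snd ` A)"
proof -
  let ?F = "snd ` A"
  have F: "?F \<in> graph.finite_sets" by (rule finite_projection[OF A])
  show ?thesis
  proof (rule layer_scale_connected[where P = "\<lambda>B. snd ` f B = induced ?F", OF F zero_less_one slab_in_layer[OF F]])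
    show "A \<in> layer ?F" using A by (simp add: layer_def)
    show "snd ` f (K \<times> ?F) = induced ?F" by (simp add: induced_def)
    fix B C assume BC: "B \<in> layer ?F" "C \<in> layer ?F" "cyl.hdist B C < 1" "snd ` f B = induced ?F"
    then have "B \<in> H" "C \<in> H" by (auto simp: layer_def)
    then have "snd ` f B = snd ` f C"
      using nonexp[of B C] f_in BC(3) by (intro projection_eq_of_close) auto
    then show "snd ` f C = induced ?F" using BC(4) by simp
  qed
qed

lemma induced_in: "F \<in> graph.finite_sets \<Longrightarrow> induced F \<in> graph.finite_sets"
  unfolding induced_def using slab_in_layer f_in finite_projection by (simp add: layer_def)

text \<open>For the representatives \<open>K \<times> F\<close> the Hausdorff distance is that of the vertex sets, while
  projections never increase it.\<close>

lemma induced_nonexpansive: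
  assumes F: "F \<in> graph.finite_sets" "F' \<in> graph.finite_sets"
    and near: "hausdorff_within \<rho> (real n) F F'"
  shows "hausdorff_within \<rho> (real n) (induced F) (induced F')"
proof -
  have S: "K \<times> F \<in> H" "K \<times> F' \<in> H" using slab_in_layer F by (auto simp: layer_def)
  have same: "D (x, u) (x, v) \<le> real n" if "\<rho> u v \<le> real n" "x \<in> K" for x u v
    using that by (simp add: sup_dist_def)
  have "hausdorff_within D (real n) (K \<times> F) (K \<times> F')"
    unfolding hausdorff_within_def
  proof (intro conjI ballI)
    fix p assume "p \<in> K \<times> F"
    then obtain v where "v \<in> F'" "\<rho> (snd p) v \<le> real n" "fst p \<in> K"
      using near unfolding hausdorff_within_def by auto
    then show "\<exists>q\<in>K \<times> F'. D p q \<le> real n"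
      using same[of "snd p" v "fst p"] by (intro bexI[of _ "(fst p, v)"]) auto
  next
    fix p assume "p \<in> K \<times> F'"
    then obtain v where "v \<in> F" "\<rho> v (snd p) \<le> real n" "fst p \<in> K"
      using near unfolding hausdorff_within_def by auto
    then show "\<exists>q\<in>K \<times> F. D q p \<le> real n"
      using same[of v "snd p" "fst p"] by (intro bexI[of _ "(fst p, v)"]) auto
  qed
  then have "cyl.hdist (f (K \<times> F)) (f (K \<times> F')) \<le> real n"
    using cyl.hdist_le_iff[OF S] nonexp[OF S] order_trans by blast
  then show ?thesis
    using cyl.hdist_le_iff f_in S hausdorff_within_projection unfolding induced_def by blast
qed

lemma induced_surj:
  assumes "G \<in> graph.finite_sets"
  shows "G \<in> induced ` graph.finite_sets"
proof -
  have "K \<times> G \<in> H" using slab_in_layer[OF assms] by (simp add: layer_def)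
  then obtain A where A: "A \<in> H" "K \<times> G = f A" using f by (auto simp: bij_betw_def)
  then have "induced (snd ` A) = G" using projection_f[OF A(1)] slab_in_layer[OF assms] by (simp add: layer_def)
  then show ?thesis using finite_projection[OF A(1)] by blast
qed

text \<open>The continuum \<open>layer G\<close> is the disjoint union of the compact sets \<open>f ` layer F\<close> over the
  countably many \<open>F\<close> with \<open>induced F = G\<close>, so by Sierpinski's theorem there is just one such \<open>F\<close>.\<close>

lemma induced_inj: "inj_on induced graph.finite_sets"
proof (rule inj_onI)
  fix F1 F2 assume F: "F1 \<in> graph.finite_sets" "F2 \<in> graph.finite_sets" "induced F1 = induced F2"
  define G where "G = induced F1"
  have G: "G \<in> graph.finite_sets" using induced_in F(1) by (simp add: G_def)
  define \<F> where "\<F> = {F \<in> graph.finite_sets. induced F = G}"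
  let ?X = "subtopology hyper.mtopology (layer G)"
  have sub: "layer F \<subseteq> H" for F by (auto simp: layer_def)
  have inj: "inj_on f H" using f by (simp add: bij_betw_def)
  have cont: "continuous_map hyper.mtopology hyper.mtopology f"
    using f_in nonexp
    by (intro nonexpansive_imp_continuous_map hyper.Metric_space_axioms) auto
  have topX: "topspace ?X = layer G" using sub by auto
  have imgs: "f ` layer F \<subseteq> layer G" if "F \<in> \<F>" for F
    using that f_in projection_f by (auto simp: layer_def \<F>_def)
  have fam: "(\<lambda>F. f ` layer F) ` \<F> = {topspace ?X}"
  proof (rule Sierpinski_countable_family)
    show "connected_space ?X" using connectedin_layer[OF G] by (simp add: connectedin_def)
    show "compact_space ?X" using compactin_layer[OF G] by (simp add: compact_space_subtopology)
    show "Hausdorff_space ?X"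
      by (intro Hausdorff_space_subtopology hyper.Hausdorff_space_mtopology)
    show "topspace ?X \<noteq> {}" using slab_in_layer[OF G] topX by blast
    have "graph.finite_sets \<subseteq> {F. finite F \<and> F \<subseteq> V}" by (auto simp: graph.finite_sets_def)
    then have "countable graph.finite_sets"
      using countable_Collect_finite_subset[OF graph.countable_vertices] countable_subset by blast
    then have "countable \<F>" by (rule countable_subset[rotated]) (auto simp: \<F>_def)
    then show "countable ((\<lambda>F. f ` layer F) ` \<F>)" by simp
    have "disjnt (f ` layer F) (f ` layer F')" if "F \<noteq> F'" for F F'
    proof -
      have "layer F \<inter> layer F' = {}" using that by (auto simp: layer_def)
      then show ?thesis using inj_on_image_Int[OF inj sub sub] by (metis disjnt_def image_empty)
    qed
    then show "pairwise disjnt ((\<lambda>F. f ` layer F) ` \<F>)" by (intro pairwise_imageI) blast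
    show "closedin ?X C \<and> C \<noteq> {}" if C: "C \<in> (\<lambda>F. f ` layer F) ` \<F>" for C
    proof -
      obtain F where F: "F \<in> \<F>" "C = f ` layer F" using C by blast
      have "compactin hyper.mtopology C"
        using F image_compactin[OF compactin_layer cont] by (simp add: \<F>_def)
      then have "closedin hyper.mtopology C"
        using compactin_imp_closedin hyper.Hausdorff_space_mtopology by blast
      moreover have "C \<subseteq> layer G" using F imgs by blast
      moreover have "C \<noteq> {}" using F slab_in_layer[of F] by (auto simp: \<F>_def)
      ultimately show ?thesis using closedin_subset_topspace by blast
    qed
    show "\<Union>((\<lambda>F. f ` layer F) ` \<F>) = topspace ?X"
      unfolding topX
    proof (intro equalityI subsetI)
      fix B assume B: "B \<in> layer G"
      then have "B \<in> f ` H" using f sub[of G] by (auto simp: bij_betw_def)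
      then obtain A where A: "A \<in> H" "f A = B" by blast
      have "induced (snd ` A) = G" using B projection_f[OF A(1)] A(2) by (simp add: layer_def)
      then have "snd ` A \<in> \<F>" "A \<in> layer (snd ` A)"
        using finite_projection[OF A(1)] A(1) by (simp_all add: \<F>_def layer_def)
      then show "B \<in> \<Union>((\<lambda>F. f ` layer F) ` \<F>)" using A(2) by (intro UN_I[of "snd ` A"]) auto
    qed (use imgs in blast)
  qed
  have "F1 \<in> \<F>" "F2 \<in> \<F>" using F by (auto simp: \<F>_def G_def)
  moreover have "f ` layer F = topspace ?X" if "F \<in> \<F>" for F
    using imageI[OF that, of "\<lambda>F. f ` layer F"] unfolding fam by simp
  ultimately have "f ` layer F1 = f ` layer F2" by simp
  then have "layer F1 = layer F2" using inj_on_image_eq_iff[OF inj sub sub] by simp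
  then have "K \<times> F1 \<in> layer F1 \<inter> layer F2" using slab_in_layer[OF F(1)] by simp
  then show "F1 = F2" unfolding layer_def by blast
qed

text \<open>Precomposing \<open>f\<close> with the isometry induced by \<open>\<gamma>\<close> gives a map \<open>g\<close> that permutes the compact
  sets over any ball of radius \<open>n \<ge> 1\<close>. Any two compact sets lie over a common ball of this kind.\<close>

theorem hyperspace_map_isometry:
  assumes AB: "A \<in> H" "B \<in> H"
  shows "cyl.hdist (f A) (f B) = cyl.hdist A B"
proof -
  have induced_bij: "bij_betw induced graph.finite_sets graph.finite_sets"
    using induced_inj induced_surj induced_in unfolding bij_betw_def by blast
  obtain \<gamma> where \<gamma>: "bij_betw \<gamma> V V" "\<And>x y. x \<in> V \<Longrightarrow> y \<in> V \<Longrightarrow> \<rho> (\<gamma> x) (\<gamma> y) = \<rho> x y"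
    and perm: "\<And>x n. x \<in> V \<Longrightarrow> n \<ge> 1 \<Longrightarrow>
      (\<lambda>F. induced (\<gamma> ` F)) ` (Pow {y \<in> V. \<rho> x y \<le> real n} - {{}}) = Pow {y \<in> V. \<rho> x y \<le> real n} - {{}}"
    using graph.vertex_automorphism[OF induced_bij induced_nonexpansive] by blast
  define s :: "'a \<times> 'v \<Rightarrow> 'a \<times> 'v" where "s = map_prod id \<gamma>"
  have s: "bij_betw s (K \<times> V) (K \<times> V)"
    unfolding s_def using \<gamma>(1) by (intro bij_betw_map_prod) auto
  have s_iso: "D (s p) (s q) = D p q" if "p \<in> K \<times> V" "q \<in> K \<times> V" for p q
    using that \<gamma>(2) by (auto simp: s_def sup_dist_def)
  have s_bij: "bij_betw ((`) s) H H"
    by (rule cyl.isometry_nonempty_compacts(1)[OF s s_iso])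
  have s_hdist: "cyl.hdist (s ` A) (s ` B) = cyl.hdist A B" if "A \<in> H" "B \<in> H" for A B
    using that by (intro cyl.isometry_nonempty_compacts(2) s s_iso)
  have \<gamma>inj: "inj_on \<gamma> V" using \<gamma>(1) by (simp add: bij_betw_def)
  have snd_s: "snd ` (s ` A) = \<gamma> ` (snd ` A)" for A by (force simp: s_def image_image)
  have sin: "s ` A \<in> H" if "A \<in> H" for A using s_bij that by (auto simp: bij_betw_def)
  define g where "g A = f (s ` A)" for A
  have g: "bij_betw g H H" unfolding g_def using bij_betw_trans[OF s_bij f] by (simp add: o_def)
  have g_ne: "cyl.hdist (g A) (g B) \<le> cyl.hdist A B" if "A \<in> H" "B \<in> H" for A B
    using nonexp[OF sin sin] s_hdist that unfolding g_def by simp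
  have snd_g: "snd ` g A = induced (\<gamma> ` (snd ` A))" if "A \<in> H" for A
    unfolding g_def using projection_f[OF sin[OF that]] snd_s by simp
  have g_iso: "cyl.hdist (g A) (g B) = cyl.hdist A B" if AB: "A \<in> H" "B \<in> H" for A B
  proof -
    obtain x where x: "x \<in> V" using finite_projection[OF AB(1)] by (auto simp: graph.finite_sets_def)
    have F: "finite (snd ` A \<union> snd ` B)" "snd ` A \<union> snd ` B \<subseteq> V"
      using finite_projection AB by (auto simp: graph.finite_sets_def)
    obtain m where m: "\<And>y. y \<in> V \<Longrightarrow> \<rho> x y \<le> real (m y)" using graph.dist_nat_le[OF x] by metis
    define n where "n = Suc (\<Sum>y\<in>snd ` A \<union> snd ` B. m y)"
    have mn: "\<rho> x y \<le> real n" if "y \<in> snd ` A \<union> snd ` B" for y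
    proof -
      have "m y \<le> n" using member_le_sum[OF that _ F(1), of m] by (simp add: n_def)
      then show ?thesis using m[of y] that F(2) by force
    qed
    define Q where "Q = Pow {y \<in> V. \<rho> x y \<le> real n} - {{}}"
    define Y where "Y = {C \<in> H. C \<subseteq> K \<times> {y \<in> V. \<rho> x y \<le> real n}}"
    have Y_iff: "C \<in> Y \<longleftrightarrow> C \<in> H \<and> snd ` C \<in> Q" for C
    proof (cases "C \<in> H")
      case True
      note C = cyl.nonempty_compactsD[OF True]
      have "C \<subseteq> K \<times> {y \<in> V. \<rho> x y \<le> real n} \<longleftrightarrow> snd ` C \<subseteq> {y \<in> V. \<rho> x y \<le> real n}"
        using C(3) by force
      then show ?thesis using True C(2) by (simp add: Y_def Q_def)
    qed (simp add: Y_def)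
    have Qperm: "(\<lambda>F. induced (\<gamma> ` F)) ` Q = Q"
      unfolding Q_def by (rule perm[OF x]) (simp add: n_def)
    have Qfin: "\<gamma> ` F \<in> graph.finite_sets" if "F \<in> Q" for F
      using that \<gamma>(1) finite_subset[OF _ graph.finite_cball[OF x, of n]]
      by (auto simp: Q_def graph.finite_sets_def bij_betw_def)
    have "g ` Y = Y"
    proof (intro equalityI subsetI)
      fix C assume "C \<in> g ` Y"
      then obtain B where B: "C = g B" "B \<in> H" "snd ` B \<in> Q" using Y_iff by blast
      then show "C \<in> Y" using snd_g[OF B(2)] Qperm g Y_iff by (auto simp: bij_betw_def)
    next
      fix C assume "C \<in> Y"
      then have C: "C \<in> H" "snd ` C \<in> Q" using Y_iff by auto
      \<comment> \<open>\<open>B\<close> need not lie over the ball a priori; injectivity of \<open>induced\<close> forces it\<close>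
      then obtain B where B: "B \<in> H" "C = g B" using g by (auto simp: bij_betw_def)
      obtain F where F: "F \<in> Q" "snd ` C = induced (\<gamma> ` F)" using C(2) Qperm by blast
      have BV: "snd ` B \<subseteq> V" using finite_projection[OF B(1)] by (simp add: graph.finite_sets_def)
      have "\<gamma> ` (snd ` B) \<in> graph.finite_sets"
        using finite_projection[OF sin[OF B(1)]] snd_s by simp
      then have "\<gamma> ` (snd ` B) = \<gamma> ` F"
        using inj_onD[OF induced_inj _ _ Qfin[OF F(1)]] snd_g[OF B(1)] F(2) B(2) by simp
      then have "snd ` B = F"
        using inj_on_image_eq_iff[OF \<gamma>inj BV, of F] F(1) unfolding Q_def by blast
      then show "C \<in> g ` Y" using B F(1) Y_iff by blast
    qed
    then have gY: "bij_betw g Y Y"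
      using g Y_iff by (auto simp: bij_betw_def intro: inj_on_subset)
    have "cyl.mtotally_bounded (K \<times> {y \<in> V. \<rho> x y \<le> real n})"
      using graph.finite_cball[OF x, of n]
      by (intro cyl.compactin_imp_mtotally_bounded compactin_slab) auto
    then have "hyper.mtotally_bounded Y"
      unfolding Y_def by (rule cyl.nonempty_compacts_mtotally_bounded)
    moreover have "A \<in> Y" "B \<in> Y"
      using AB mn finite_projection[OF AB(1)] finite_projection[OF AB(2)]
      by (auto simp: Y_iff Q_def graph.finite_sets_def)
    ultimately show ?thesis
      using hyper.nonexpansive_bij_isometry[OF _ gY] g_ne Y_iff by blast
  qed
  have "(`) s ` H = H" using s_bij by (simp add: bij_betw_def)
  then have pre: "A \<in> (`) s ` H" "B \<in> (`) s ` H" using AB by simp_all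
  obtain A' where A': "A = s ` A'" "A' \<in> H" using pre(1) by (rule imageE)
  obtain B' where B': "B = s ` B'" "B' \<in> H" using pre(2) by (rule imageE)
  show ?thesis using g_iso[OF A'(2) B'(2)] s_hdist[OF A'(2) B'(2)] A'(1) B'(1) by (simp add: g_def)
qed

end

lemma plastic_hyperspace: "plastic H (hausdorff_dist D)"
  unfolding plastic_def
proof (intro allI impI ballI)
  fix f A B
  assume f: "bij_betw f H H \<and> nonexpansive_on H (hausdorff_dist D) f" and AB: "A \<in> H" "B \<in> H"
  have fH: "f A \<in> H" if "A \<in> H" for A using f that by (auto simp: bij_betw_def)
  have "cyl.hdist (f A) (f B) = cyl.hdist A B"
  proof (rule hyperspace_map_isometry)
    show "cyl.hdist (f A) (f B) \<le> cyl.hdist A B" if "A \<in> H" "B \<in> H" for A B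
      using f that fH by (simp add: cyl.hdist_def nonexpansive_on_def)
  qed (use f AB in auto)
  then show "hausdorff_dist D (f A) (f B) = hausdorff_dist D A B"
    using AB fH by (simp add: cyl.hdist_def)
qed

end

section \<open>Path metrics of regular graphs\<close>

lemma path_dist_le_iff:
  assumes G: "simple_graph G" "Digraph_Component.connected (with_proj G)"
    and uv: "u \<in> pverts G" "v \<in> pverts G"
  shows "path_dist G u v \<le> real n \<longleftrightarrow> (\<exists>p. pre_digraph.awalk (with_proj G) u p v \<and> length p \<le> n)"
proof -
  interpret pair_bidirected_digraph G by fact
  define P where "P m \<longleftrightarrow> (\<exists>p. awalk u p v \<and> length p = m)" for m
  define l where "l = (LEAST m. P m)"
  have pd: "path_dist G u v = real l"
    by (simp add: path_dist_def P_def l_def)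
  have "u \<rightarrow>\<^sup>*\<^bsub>with_proj G\<^esub> v"
    using uv G(2) unfolding Digraph_Component.connected_def strongly_connected_def
    by (simp add: reachable_mk_symmetric_eq[OF pair_sym_arcs])
  then have "\<exists>m. P m"
    unfolding reachable_awalk P_def by blast
  then have "P l"
    unfolding l_def by (rule LeastI_ex)
  moreover have "l \<le> m" if "P m" for m
    unfolding l_def using that by (rule Least_le)
  ultimately have "l \<le> n \<longleftrightarrow> (\<exists>m\<le>n. P m)"
    using order_trans by blast
  then show ?thesis by (auto simp: pd P_def)
qed

lemma regular_graph_metric_path_dist:
  assumes G: "simple_graph G" "Digraph_Component.connected (with_proj G)"
    and fin: "locally_finite G" and deg: "\<And>v. v \<in> pverts G \<Longrightarrow> out_degree (with_proj G) v = k"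
  shows "regular_graph_metric (pverts G) (path_dist G) k"
proof -
  interpret pair_bidirected_digraph G by fact
  interpret Metric_space "pverts G" "path_dist G" by (rule Metric_space_path_dist[OF G])
  note le_iff = path_dist_le_iff[OF G]
  have single: "awalk u [e] v \<longleftrightarrow> e \<in> parcs G \<and> e = (u, v)" for u e v
    using in_arcsD1 in_arcsD2 by (cases e) (auto simp: awalk_Cons_iff awalk_Nil_iff)
  show ?thesis
  proof
    fix x y assume xy: "x \<in> pverts G" "y \<in> pverts G"
    show "\<exists>n. path_dist G x y = real n" by (simp add: path_dist_def)
    fix n assume "path_dist G x y \<le> real (Suc n)"
    then obtain p where p: "awalk x p y" "length p \<le> Suc n"
      using le_iff[OF xy] by blast
    show "\<exists>z\<in>pverts G. path_dist G x z \<le> real n \<and> path_dist G z y \<le> 1"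
    proof (cases p rule: rev_cases)
      case Nil
      then have "x = y" using p(1) by (simp add: awalk_Nil_iff)
      then show ?thesis using xy by (intro bexI[of _ x]) auto
    next
      case (snoc q e)
      then obtain z where z: "awalk x q z" "awalk z [e] y" using p(1) by (auto simp: awalk_append_iff)
      then have zV: "z \<in> pverts G" by auto
      then have "path_dist G x z \<le> real n" using z(1) p(2) snoc le_iff[OF xy(1) zV] by auto
      moreover have "path_dist G z y \<le> real 1"
        unfolding le_iff[OF zV xy(2)] using z(2) by (intro exI[of _ "[e]"]) simp
      ultimately show ?thesis using zV by auto
    qed
  next
    fix x assume x: "x \<in> pverts G"
    have fin_out: "finite (out_arcs (with_proj G) x)" using fin x by (simp add: locally_finite_def)
    have le1: "path_dist G x y \<le> 1 \<longleftrightarrow> y = x \<or> (x, y) \<in> parcs G" if y: "y \<in> pverts G" for y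
    proof -
      have short: "length p \<le> 1 \<longleftrightarrow> p = [] \<or> (\<exists>e. p = [e])" for p :: "('a \<times> 'a) list"
        by (cases p) auto
      have "path_dist G x y \<le> 1 \<longleftrightarrow> (\<exists>p. awalk x p y \<and> length p \<le> 1)"
        using le_iff[OF x y, of 1] by simp
      also have "\<dots> \<longleftrightarrow> awalk x [] y \<or> (\<exists>e. awalk x [e] y)"
        unfolding short by blast
      also have "\<dots> \<longleftrightarrow> y = x \<or> (x, y) \<in> parcs G"
        using single x by (auto simp: awalk_Nil_iff)
      finally show ?thesis .
    qed
    have "{y \<in> pverts G. path_dist G x y \<le> 1} = insert x (snd ` out_arcs (with_proj G) x)"
      using le1 x in_arcsD2 by (force simp: out_arcs_def)
    moreover have "x \<notin> snd ` out_arcs (with_proj G) x"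
      using no_loops by (auto simp: out_arcs_def)
    moreover have "card (snd ` out_arcs (with_proj G) x) = k"
      using deg[OF x] by (subst card_image) (auto simp: inj_on_def out_arcs_def out_degree_def)
    ultimately show "card {y \<in> pverts G. path_dist G x y \<le> 1} = Suc k"
      using fin_out by simp
  qed
qed

section \<open>Plasticity\<close>

lemma plastic_cylinder:
  assumes K: "Metric_space K d" "compact_space (Metric_space.mtopology K d)"
      "connected_space (Metric_space.mtopology K d)"
    and G: "simple_graph G" "Digraph_Component.connected (with_proj G)" "locally_finite G" "regular G"
  shows "plastic (nonempty_compacts (K \<times> pverts G) (sup_dist d (path_dist G)))
           (hausdorff_dist (sup_dist d (path_dist G)))"
proof (cases "K = {}")
  case True
  \<comment> \<open>over an empty base there are no nonempty compact sets\<close>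
  interpret Metric_space "K \<times> pverts G" "sup_dist d (path_dist G)"
    by (intro Metric_space_sup_dist Metric_space_path_dist K G)
  have "nonempty_compacts (K \<times> pverts G) (sup_dist d (path_dist G)) = {}"
    using True nonempty_compactsD by blast
  then show ?thesis by (simp add: plastic_def)
next
  case False
  obtain k where "\<And>v. v \<in> pverts G \<Longrightarrow> out_degree (with_proj G) v = k"
    using G(4) by (auto simp: regular_def)
  then interpret graph: regular_graph_metric "pverts G" "path_dist G" k
    using G by (intro regular_graph_metric_path_dist)
  interpret base: Metric_space K d by fact
  interpret graph_cylinder K d "pverts G" "path_dist G" k
    by unfold_locales (use K False in auto)
  show ?thesis by (rule plastic_hyperspace)
qed

theorem corollary5p6:
  fixes K :: "'a set" and d :: "'a \<Rightarrow> 'a \<Rightarrow> real"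
  assumes "Metric_space K d"
    and "compact_space (Metric_space.mtopology K d)"
    and "connected_space (Metric_space.mtopology K d)"
  shows "(\<forall>G :: 'b pair_pre_digraph.
            simple_graph G \<and> infinite (pverts G) \<and> Digraph_Component.connected (with_proj G) \<and>
            locally_finite G \<and> regular G \<longrightarrow>
            plastic (nonempty_compacts (K \<times> pverts G) (sup_dist d (path_dist G)))
                    (hausdorff_dist (sup_dist d (path_dist G)))) \<and>
         (\<forall>k\<ge>2. \<forall>T :: 'c pair_pre_digraph. is_regular_tree k T \<longrightarrow>
            plastic (nonempty_compacts (K \<times> pverts T) (sup_dist d (path_dist T)))
                    (hausdorff_dist (sup_dist d (path_dist T))))"
proof (intro conjI allI impI)
  fix G :: "'b pair_pre_digraph"
  assume "simple_graph G \<and> infinite (pverts G) \<and> Digraph_Component.connected (with_proj G) \<and>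
    locally_finite G \<and> regular G"
  then show "plastic (nonempty_compacts (K \<times> pverts G) (sup_dist d (path_dist G)))
      (hausdorff_dist (sup_dist d (path_dist G)))"
    using plastic_cylinder[OF assms] by blast
next
  fix k :: nat and T :: "'c pair_pre_digraph"
  assume "is_regular_tree k T"
  then have "simple_graph T" "Digraph_Component.connected (with_proj T)" "locally_finite T" "regular T"
    by (auto simp: is_regular_tree_def undirected_tree_def regular_def)
  then show "plastic (nonempty_compacts (K \<times> pverts T) (sup_dist d (path_dist T)))
      (hausdorff_dist (sup_dist d (path_dist T)))"
    by (rule plastic_cylinder[OF assms])
qed

end
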